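(* For every instance of the collaborative bandit model (described in the context) there is $T_0\in\mathbb{N}$ such that for all horizons $T\ge T_0$, when the algorithm CExp$^2$ (described in the context) is run with horizon $T$ and with $\pi'$ equal to W-CPE-Reg: (i) the expected number of communication rounds is at most $$2+\frac{\left\lceil\log_2\left(\frac{8}{\Delta'_{\min}}\right)\right\rceil}{\log(T)};$$ (ii) with probability at least $1-\frac{1}{\log(T)}$, the number of communication rounds is exactly $2$.
   Context: **Notation.** $[N]=\{1,\dots,N\}$. $\mathbb{R}^+$ denotes the nonnegative reals; in expressions $w^2/q$ use $0/0=0$ and $a/0=+\infty$ for $a>0$. If an argmin or argmax is not unique, any element may be chosen. **Model.** There are $K\ge 2$ arms and $M\ge 1$ agents, and a horizon $T$. At each time $t\in[T]$ each agent $m\in[M]$ may select an arm $\pi_m(t)=k\in[K]$ and then observes a local reward $X_{k,m}(t)$. Rewards are independent across $k,m$ and i.i.d. across $t$, with law $\nu_{k,m}$ that is $\sigma$-sub-Gaussian ($\mathbb{E}[e^{\eta(X-\mathbb{E}X)}]\le e^{\eta^2\sigma^2/2}$ for all $\eta\in\mathbb{R}$) and mean $\mu_{k,m}$. A known weight matrix $W=(w_{n,m})\in[0,1]^{M\times M}$ satisfies $\sum_{n}w_{n,m}=1$ for all $m$. Expected mixed rewards: $\mu'_{k,m}=\sum_{n=1}^M w_{n,m}\mu_{k,n}$. The arm $k^*_m=\arg\max_k\mu'_{k,m}$ is assumed unique. Gaps: $\Delta'_{k,m}=\mu'_{k^*_m,m}-\mu'_{k,m}$; $\tilde\Delta'_{k,m}=\Delta'_{k,m}$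 for $k\ne k^*_m$ and $\tilde\Delta'_{k^*_m,m}=\min_{k\neq k^*_m}\Delta'_{k,m}$; $\Delta'_{\min}=\min_{k,m}\tilde\Delta'_{k,m}$. An instance consists of $K,M,W$ and $(\nu_{k,m})$. Agents may communicate: in a communication round, all agents send the sample means of their local observations to a server, which broadcasts them to all agents. An agent that has completed its prescribed plays of a phase before the other agents stays idle until the phase ends. **Oracle.** For $\Delta$ with positive entries, $\mathcal{P}(\Delta)$ is the argmin over $q\in(\mathbb{R}^+)^{K\times M}$ of $\sum_{k,m}q_{k,m}\Delta_{k,m}$ subject to $\sum_{n\in[M]}w_{n,m}^2/q_{k,n}\le\Delta_{k,m}^2/2$ for all $k,m$. **Sample means and confidence widths.** $\tau_{k,m}(t)$ is the number of plays of arm $k$ by agent $m$ up to time $t$; $\hat\mu_{k,m}(t)$ is the sample mean of these observations; $\hat\mu'_{k,m}(t)=\sum_{n=1}^M w_{n,m}\hat\mu_{k,n}(t)$. The estimated gaps $\hat\Delta'_{k,m}(t)$ are defined from $\hat\mu'(t)$ as $\tilde\Delta'$ is from $\mu'$: $\max_j\hat\mu'_{j,m}(t)-\hat\mu'_{k,m}(t)$ if $k$ is not the empirically best arm of agent $m$, and the difference between the largest and second largest empirical mixed means if it is. For $\delta\in(0,1)$, $$\Omega^\delta_{k,m}(t)=\sqrt{\beta_\delta(\tau_{k,\cdot}(t))\sum_{n=1}^M\frac{w_{n,m}^2}{\tau_{k,n}(t)}},\qquad \beta_\delta(N)=2\Big(g_M\big(\tfrac{\delta}{KM}\big)+2\sum_{m=1}^M\log(4+\log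 N_m)\Big)$$ (width $+\infty$ if some $\tau_{k,n}(t)=0$). Here $g_M$ is a fixed nonincreasing function (due to Kaufmann and Koolen) with $g_M(\delta)\simeq\log(1/\delta)+M\log\log(1/\delta)$ (ratio tending to $1$ as $\delta\to0$), for which, in this model, for every $\delta\in(0,1)$, with probability at least $1-\delta$: $|\hat\mu'_{k,m}(t)-\mu'_{k,m}|\le\Omega^\delta_{k,m}(t)$ for all $t\in\mathbb{N}$, $k$, $m$. **Algorithm CExp$^2$** (horizon $T$). Let $\delta'=1/T$ and $B(T)=\beta_{\delta'}(T,\dots,T)=2\big(g_M(\tfrac{1}{KMT})+2M\log(4+\log T)\big)$. 1. *Initial exploration.* Each agent plays each arm $\tau_1=\lceil\sqrt{\log T}\rceil$ times. Let $T_{\rm ie}$ be the end of this phase. Agents communicate (one round) and compute $\hat\Delta'_{k,m}(T_{\rm ie})$. 2. *Guided exploration.* Set $\hat\Delta^{\rm ge}_{k,m}=\min\{\max\{\hat\Delta'_{k,m}(T_{\rm ie}),\tfrac1{\log\log T}\},\log\log T\}$ and $q^{\rm ge}=\mathcal{P}(\hat\Delta^{\rm ge})$. Each agent $m$ plays each arm $k$ until its total number of plays is $\tau^{\rm ge}_{k,m}=\max\{\tau_1,\lceil18q^{\rm ge}_{k,m}B(T)\rceil\}$. Let $T_{\rm ge}$ be the end of this phase. Agents communicate (one round) and compute $\hat\mu'_{k,m}(T_{\rm ge})$, $\hat\Delta'_{k,m}(T_{\rm ge})$. 3. *Exploitation/switch.* If condition $\mathcal{C}$ holds, namely $\Omega^{\delta'}_{k,m}(T_{\rm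 ge})<\hat\Delta'_{k,m}(T_{\rm ge})/2$ for all $k,m$, each agent $m$ plays $\arg\max_k\hat\mu'_{k,m}(T_{\rm ge})$ until time $T$, without further communication. Otherwise all data are reset and the policy $\pi'$ is played until time $T$. **W-CPE-Reg.** Run W-CPE-BAI (Réda et al., 2022) with $\delta=1/T$ until it stops (or time $T$ is reached); then each agent $m$ plays its returned arm $\hat k_m$ for the remaining time. W-CPE-BAI: each agent first plays each arm once; set $r=0$, $\mathcal{B}_m(0)=[K]$ and $D_{k,m}(0)=1$. Repeat until $|\mathcal{B}_m(r)|=1$ for all $m$, then output these single arms. In phase $r$: let $t(r)$ be the argmin of $\sum_{k,m}q_{k,m}$ over $q\in(\mathbb{R}^+)^{K\times M}$ subject to $\sum_n w_{n,m}^2/q_{k,n}\le(\sqrt2 D_{k,m}(r))^2/2$ for all $k,m$. With $n_{k,m}$ the current play counts, for each $k$ let $(d_{k,m})_m\in\mathbb{N}^M$ minimize $\sum_m d_m$ subject to $(n_{k,m}+d_m)/\beta_\delta(n_{k,\cdot}+d)\ge t_{k,m}(r)$ for all $m$. Agent $m$ plays each $k\in\bigcup_n\mathcal{B}_n(r)$ exactly $d_{k,m}$ times; agents communicate (one round). With the updated $\hat\mu'$ and $\Omega^\delta$, set $\mathcal{B}_m(r+1)=\{k\in\mathcal{B}_m(r):\hat\mu'_{k,m}+\Omega^\delta_{k,m}\ge\max_{j\in\mathcal{B}_m(r)}(\hat\mu'_{j,m}-\Omega^\delta_{j,m})\}$; set $D_{k,m}(r+1)=D_{k,m}(r)/2$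 if $k\in\mathcal{B}_m(r+1)$ and $|\mathcal{B}_m(r+1)|>1$, and $D_{k,m}(r+1)=D_{k,m}(r)$ otherwise; increase $r$ by $1$.
   Formalization: In (i) the ceiling ⌈log₂(8/Δ'_min)⌉ is replaced by max(1, ⌈log₂(8/Δ'_min)⌉). This changes nothing when Δ'_min < 8; for Δ'_min ≥ 8 the printed bound is at most 2 and fails, e.g. for Gaussian rewards. *)

theory Defs
  imports "HOL-Probability.Probability" "HOL-Library.Extended_Nat"
begin

text \<open>
  Arms are \<open>k < K\<close>, agents are \<open>m < M\<close>, and time is counted from 1.  Matrices indexed by an arm and
  an agent are functions \<open>nat \<Rightarrow> nat \<Rightarrow> _\<close> (arm first); the weight matrix is \<open>W n m\<close>.  Values
  outside these ranges are never used.
\<close>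

section \<open>Instances\<close>

definition sub_gaussian :: "real \<Rightarrow> real measure \<Rightarrow> bool" where
  "sub_gaussian \<sigma> \<nu> \<longleftrightarrow>
     prob_space \<nu> \<and> sets \<nu> = sets borel \<and> integrable \<nu> (\<lambda>y. y) \<and>
     (\<forall>\<eta>::real.
        integrable \<nu> (\<lambda>y. exp (\<eta> * (y - (\<integral>z. z \<partial>\<nu>)))) \<and>
        (\<integral>y. exp (\<eta> * (y - (\<integral>z. z \<partial>\<nu>))) \<partial>\<nu>) \<le> exp (\<eta>\<^sup>2 * \<sigma>\<^sup>2 / 2))"

definition mixed :: "nat \<Rightarrow> (nat \<Rightarrow> nat \<Rightarrow> real) \<Rightarrow> (nat \<Rightarrow> nat \<Rightarrow> real) \<Rightarrow> nat \<Rightarrow> nat \<Rightarrow> real" where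
  "mixed M W v k m = (\<Sum>n<M. W n m * v k n)"

abbreviation law_mean :: "(nat \<Rightarrow> nat \<Rightarrow> real measure) \<Rightarrow> nat \<Rightarrow> nat \<Rightarrow> real" where
  "law_mean \<nu> k m \<equiv> (\<integral>y. y \<partial>\<nu> k m)"

definition bandit_instance ::
  "nat \<Rightarrow> nat \<Rightarrow> (nat \<Rightarrow> nat \<Rightarrow> real) \<Rightarrow> real \<Rightarrow> (nat \<Rightarrow> nat \<Rightarrow> real measure) \<Rightarrow> bool" where
  "bandit_instance K M W \<sigma> \<nu> \<longleftrightarrow>
     2 \<le> K \<and> 1 \<le> M \<and>
     (\<forall>n<M. \<forall>m<M. 0 \<le> W n m \<and> W n m \<le> 1) \<and>
     (\<forall>m<M. (\<Sum>n<M. W n m) = 1) \<and>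
     (\<forall>k<K. \<forall>m<M. sub_gaussian \<sigma> (\<nu> k m)) \<and>
     (\<forall>m<M. \<exists>!k. k < K \<and> (\<forall>j<K. mixed M W (law_mean \<nu>) j m \<le> mixed M W (law_mean \<nu>) k m))"

text \<open>
  The gap of an arm \<open>k\<close> for the scores \<open>v\<close> of one agent: the distance to the best arm if \<open>k\<close> is not
  best, and the distance to the second best arm if it is.  If several arms are best, all of them
  have gap 0, so the result does not depend on which of them is called the best one.
\<close>

definition gap :: "nat \<Rightarrow> (nat \<Rightarrow> real) \<Rightarrow> nat \<Rightarrow> real" where
  "gap K v k =
     (if \<forall>j<K. v j \<le> v k then (MIN j\<in>{..<K} - {k}. v k - v j)
      else (MAX j\<in>{..<K}. v j) - v k)"

abbreviation gaps :: "nat \<Rightarrow> (nat \<Rightarrow> nat \<Rightarrow> real) \<Rightarrow> nat \<Rightarrow> nat \<Rightarrow> real" where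
  "gaps K v k m \<equiv> gap K (\<lambda>j. v j m) k"

text \<open>
  Gaps are not bounded above: \<open>\<lceil>log 2 (8 / min_gap)\<rceil>\<close> is 0 or negative as soon as the minimal gap is at
  least 8.  A number of communication rounds is therefore compared with the maximum of 1 and this
  value, which is the value itself whenever the minimal gap is less than 8.
\<close>

definition min_gap ::
  "nat \<Rightarrow> nat \<Rightarrow> (nat \<Rightarrow> nat \<Rightarrow> real) \<Rightarrow> (nat \<Rightarrow> nat \<Rightarrow> real measure) \<Rightarrow> real" where
  "min_gap K M W \<nu> = (MIN k\<in>{..<K}. MIN m\<in>{..<M}. gaps K (mixed M W (law_mean \<nu>)) k m)"

section \<open>Rewards, decisions and empirical quantities\<close>

text \<open>
  A sample point \<open>x\<close> is the table of all rewards: \<open>x (k, m, t)\<close> is the reward agent \<open>m\<close> observes if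
  it plays arm \<open>k\<close> at time \<open>t\<close>.
\<close>

type_synonym table = "nat \<times> nat \<times> nat \<Rightarrow> real"

definition reward_space :: "nat \<Rightarrow> nat \<Rightarrow> (nat \<Rightarrow> nat \<Rightarrow> real measure) \<Rightarrow> table measure" where
  "reward_space K M \<nu> = (\<Pi>\<^sub>M (k, m, t)\<in>{..<K} \<times> {..<M} \<times> {1..}. \<nu> k m)"

text \<open>
  Along a fixed sample point, \<open>a t m\<close> is the decision of agent \<open>m\<close> at time \<open>t\<close>, \<open>None\<close> meaning idle.
  Counts and means are taken over the times \<open>u\<close> with \<open>s < u \<le> t\<close>; a positive \<open>s\<close> is the time of a
  reset of the data.
\<close>

type_synonym decisions = "nat \<Rightarrow> nat \<Rightarrow> nat option"

definition plays :: "decisions \<Rightarrow> nat \<Rightarrow> nat \<Rightarrow> nat \<Rightarrow> nat \<Rightarrow> nat" where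
  "plays a s t k m = card {u \<in> {s<..t}. a u m = Some k}"

definition sample_mean :: "decisions \<Rightarrow> table \<Rightarrow> nat \<Rightarrow> nat \<Rightarrow> nat \<Rightarrow> nat \<Rightarrow> real" where
  "sample_mean a x s t k m =
     (\<Sum>u \<in> {u \<in> {s<..t}. a u m = Some k}. x (k, m, u)) / real (plays a s t k m)"

abbreviation mixed_mean ::
  "nat \<Rightarrow> (nat \<Rightarrow> nat \<Rightarrow> real) \<Rightarrow> decisions \<Rightarrow> table \<Rightarrow> nat \<Rightarrow> nat \<Rightarrow> nat \<Rightarrow> nat \<Rightarrow> real" where
  "mixed_mean M W a x s t \<equiv> mixed M W (sample_mean a x s t)"

definition beta :: "nat \<Rightarrow> nat \<Rightarrow> (real \<Rightarrow> real) \<Rightarrow> real \<Rightarrow> (nat \<Rightarrow> nat) \<Rightarrow> real" where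
  "beta K M g \<delta> N =
     2 * (g (\<delta> / (real K * real M)) + 2 * (\<Sum>m<M. ln (4 + ln (real (N m)))))"

definition width ::
  "nat \<Rightarrow> nat \<Rightarrow> (nat \<Rightarrow> nat \<Rightarrow> real) \<Rightarrow> (real \<Rightarrow> real) \<Rightarrow> real \<Rightarrow> (nat \<Rightarrow> nat \<Rightarrow> nat) \<Rightarrow>
   nat \<Rightarrow> nat \<Rightarrow> ereal" where
  "width K M W g \<delta> \<tau> k m =
     (if \<exists>n<M. \<tau> k n = 0 then \<infinity>
      else ereal (sqrt (beta K M g \<delta> (\<tau> k) * (\<Sum>n<M. (W n m)\<^sup>2 / real (\<tau> k n)))))"

text \<open>
  A sampling rule is non-anticipating if the decisions taken at time \<open>t\<close> are measurable functions of
  the rewards observed by the agents at the times \<open>1, \<dots>, t - 1\<close>.  The placeholder 0 for an idle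
  agent carries no information, since earlier decisions are themselves functions of the observed
  rewards.
\<close>

definition observed :: "(nat \<Rightarrow> nat \<Rightarrow> table \<Rightarrow> nat option) \<Rightarrow> nat \<Rightarrow> nat \<Rightarrow> table \<Rightarrow> real" where
  "observed a s m x = (case a s m x of None \<Rightarrow> 0 | Some k \<Rightarrow> x (k, m, s))"

definition past ::
  "nat \<Rightarrow> nat \<Rightarrow> (nat \<Rightarrow> nat \<Rightarrow> real measure) \<Rightarrow> (nat \<Rightarrow> nat \<Rightarrow> table \<Rightarrow> nat option) \<Rightarrow> nat \<Rightarrow>
   table measure" where
  "past K M \<nu> a t =
     vimage_algebra (space (reward_space K M \<nu>))
       (\<lambda>x. \<lambda>p\<in>{1..<t} \<times> {..<M}. observed a (fst p) (snd p) x)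
       (\<Pi>\<^sub>M p\<in>{1..<t} \<times> {..<M}. borel)"

definition non_anticipating ::
  "nat \<Rightarrow> nat \<Rightarrow> (nat \<Rightarrow> nat \<Rightarrow> real measure) \<Rightarrow> (nat \<Rightarrow> nat \<Rightarrow> table \<Rightarrow> nat option) \<Rightarrow> bool" where
  "non_anticipating K M \<nu> a \<longleftrightarrow>
     (\<forall>t\<ge>1. \<forall>m<M.
        (\<forall>x\<in>space (reward_space K M \<nu>). a t m x \<in> insert None (Some ` {..<K})) \<and>
        a t m \<in> past K M \<nu> a t \<rightarrow>\<^sub>M count_space UNIV)"

text \<open>The properties of the function \<open>g\<close> in the confidence widths, for the given instance.\<close>

definition threshold_function ::
  "nat \<Rightarrow> nat \<Rightarrow> (nat \<Rightarrow> nat \<Rightarrow> real) \<Rightarrow> (nat \<Rightarrow> nat \<Rightarrow> real measure) \<Rightarrow> (real \<Rightarrow> real) \<Rightarrow> bool" where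
  "threshold_function K M W \<nu> g \<longleftrightarrow>
     antimono_on {0<..<1} g \<and>
     ((\<lambda>\<delta>. g \<delta> / (ln (1 / \<delta>) + real M * ln (ln (1 / \<delta>)))) \<longlongrightarrow> 1) (at_right 0) \<and>
     (\<forall>a. non_anticipating K M \<nu> a \<longrightarrow>
        (\<forall>\<delta>. 0 < \<delta> \<and> \<delta> < 1 \<longrightarrow>
           measure (reward_space K M \<nu>)
             {x \<in> space (reward_space K M \<nu>). \<forall>t. \<forall>k<K. \<forall>m<M.
                ereal \<bar>mixed_mean M W (\<lambda>u n. a u n x) x 0 t k m - mixed M W (law_mean \<nu>) k m\<bar>
                \<le> width K M W g \<delta> (plays (\<lambda>u n. a u n x) 0 t) k m}
           \<ge> 1 - \<delta>))"

section \<open>Phases and allocation problems\<close>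

text \<open>
  In a phase that starts after time \<open>s\<close>, agent \<open>m\<close> has to play arm \<open>k\<close> exactly \<open>d k m\<close> times, in any
  order; it is busy for its first \<open>\<Sum>k<K. d k m\<close> time steps and then idle until the last agent has
  finished.  A phase whose end lies beyond \<open>T\<close> is cut off at \<open>T\<close>.  If it is not cut off, the
  inequality on the play counts is an equality, because both sides have the same sum over \<open>k\<close>.
\<close>

definition phase_end :: "nat \<Rightarrow> nat \<Rightarrow> nat \<Rightarrow> (nat \<Rightarrow> nat \<Rightarrow> nat) \<Rightarrow> nat" where
  "phase_end K M s d = s + (MAX m\<in>{..<M}. \<Sum>k<K. d k m)"

definition phase :: "nat \<Rightarrow> nat \<Rightarrow> nat \<Rightarrow> decisions \<Rightarrow> nat \<Rightarrow> (nat \<Rightarrow> nat \<Rightarrow> nat) \<Rightarrow> bool" where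
  "phase K M T a s d \<longleftrightarrow>
     (let e = min T (phase_end K M s d) in
      \<forall>m<M.
        (\<forall>t\<in>{s<..e}. if t \<le> s + (\<Sum>k<K. d k m) then \<exists>k<K. a t m = Some k else a t m = None) \<and>
        (\<forall>k<K. plays a s e k m \<le> d k m))"

text \<open>
  Division in \<open>ennreal\<close> satisfies \<open>0 / 0 = 0\<close> and \<open>b / 0 = \<infinity>\<close> for \<open>b > 0\<close>.
\<close>

definition feasible ::
  "nat \<Rightarrow> nat \<Rightarrow> (nat \<Rightarrow> nat \<Rightarrow> real) \<Rightarrow> (nat \<Rightarrow> nat \<Rightarrow> real) \<Rightarrow> (nat \<Rightarrow> nat \<Rightarrow> real) \<Rightarrow> bool" where
  "feasible K M W \<Delta> q \<longleftrightarrow>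
     (\<forall>k<K. \<forall>m<M. 0 \<le> q k m \<and>
        (\<Sum>n<M. ennreal ((W n m)\<^sup>2) / ennreal (q k n)) \<le> ennreal ((\<Delta> k m)\<^sup>2 / 2))"

definition oracle_argmin ::
  "nat \<Rightarrow> nat \<Rightarrow> (nat \<Rightarrow> nat \<Rightarrow> real) \<Rightarrow> (nat \<Rightarrow> nat \<Rightarrow> real) \<Rightarrow> (nat \<Rightarrow> nat \<Rightarrow> real) \<Rightarrow> bool" where
  "oracle_argmin K M W \<Delta> = is_arg_min (\<lambda>q. \<Sum>k<K. \<Sum>m<M. q k m * \<Delta> k m) (feasible K M W \<Delta>)"

definition sample_argmin ::
  "nat \<Rightarrow> nat \<Rightarrow> (nat \<Rightarrow> nat \<Rightarrow> real) \<Rightarrow> (nat \<Rightarrow> nat \<Rightarrow> real) \<Rightarrow> (nat \<Rightarrow> nat \<Rightarrow> real) \<Rightarrow> bool" where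
  "sample_argmin K M W \<Delta> = is_arg_min (\<lambda>q. \<Sum>k<K. \<Sum>m<M. q k m) (feasible K M W \<Delta>)"

section \<open>W-CPE-Reg\<close>

text \<open>
  \<open>wcpe_loop K M W g T a x s0 s Bs D c\<close>: from time \<open>s\<close> on, with sets \<open>Bs\<close> of remaining arms and
  parameters \<open>D\<close>, the decisions follow W-CPE-Reg up to time \<open>T\<close>, with confidence parameter
  \<open>1 / T\<close> and data collected since time \<open>s0\<close>, and \<open>c\<close> communication rounds take place.  The
  predicate is coinductive with \<open>c\<close> in \<open>enat\<close>, so that an endless repetition of phases without plays
  would be a run with infinitely many rounds and not the absence of a run.
\<close>

definition wcpe_alloc ::
  "nat \<Rightarrow> (real \<Rightarrow> real) \<Rightarrow> nat \<Rightarrow> nat \<Rightarrow> (nat \<Rightarrow> real) \<Rightarrow> (nat \<Rightarrow> nat) \<Rightarrow> (nat \<Rightarrow> nat) \<Rightarrow> bool" where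
  "wcpe_alloc K g M T tt n =
     is_arg_min (\<lambda>d. \<Sum>m<M. d m)
       (\<lambda>d. \<forall>m<M. tt m \<le> real (n m + d m) / beta K M g (1 / real T) (\<lambda>i. n i + d i))"

definition wcpe_plays :: "nat \<Rightarrow> (nat \<Rightarrow> nat set) \<Rightarrow> (nat \<Rightarrow> nat \<Rightarrow> nat) \<Rightarrow> nat \<Rightarrow> nat \<Rightarrow> nat" where
  "wcpe_plays M Bs d k m = (if k \<in> (\<Union>n<M. Bs n) then d k m else 0)"

definition wcpe_sets ::
  "nat \<Rightarrow> nat \<Rightarrow> (nat \<Rightarrow> nat \<Rightarrow> real) \<Rightarrow> (real \<Rightarrow> real) \<Rightarrow> nat \<Rightarrow> decisions \<Rightarrow> table \<Rightarrow> nat \<Rightarrow> nat \<Rightarrow>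
   (nat \<Rightarrow> nat set) \<Rightarrow> nat \<Rightarrow> nat set" where
  "wcpe_sets K M W g T a x s0 e Bs m =
     (let mu = (\<lambda>k. ereal (mixed_mean M W a x s0 e k m));
          om = (\<lambda>k. width K M W g (1 / real T) (plays a s0 e) k m)
      in {k \<in> Bs m. mu k + om k \<ge> (MAX j\<in>Bs m. mu j - om j)})"

definition wcpe_halve ::
  "(nat \<Rightarrow> nat set) \<Rightarrow> (nat \<Rightarrow> nat \<Rightarrow> real) \<Rightarrow> nat \<Rightarrow> nat \<Rightarrow> real" where
  "wcpe_halve Bs D k m = (if k \<in> Bs m \<and> 1 < card (Bs m) then D k m / 2 else D k m)"

coinductive wcpe_loop ::
  "nat \<Rightarrow> nat \<Rightarrow> (nat \<Rightarrow> nat \<Rightarrow> real) \<Rightarrow> (real \<Rightarrow> real) \<Rightarrow> nat \<Rightarrow> decisions \<Rightarrow> table \<Rightarrow> nat \<Rightarrow>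
   nat \<Rightarrow> (nat \<Rightarrow> nat set) \<Rightarrow> (nat \<Rightarrow> nat \<Rightarrow> real) \<Rightarrow> enat \<Rightarrow> bool"
  for K M W g T a x s0 where
  stopped:
    "wcpe_loop K M W g T a x s0 s Bs D 0"
    if "\<forall>m<M. card (Bs m) = 1"
       "\<forall>m<M. \<forall>t\<in>{s<..T}. a t m = Some (the_elem (Bs m))"
| horizon_reached:
    "wcpe_loop K M W g T a x s0 s Bs D 0"
    if "\<exists>m<M. card (Bs m) \<noteq> 1" "T \<le> s"
| phase_cut_off:
    "wcpe_loop K M W g T a x s0 s Bs D 0"
    if "\<exists>m<M. card (Bs m) \<noteq> 1" "s < T"
       "sample_argmin K M W (\<lambda>k m. sqrt 2 * D k m) tt"
       "\<forall>k<K. wcpe_alloc K g M T (tt k) (plays a s0 s k) (d k)"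
       "phase K M T a s (wcpe_plays M Bs d)"
       "T < phase_end K M s (wcpe_plays M Bs d)"
| phase_completed:
    "wcpe_loop K M W g T a x s0 s Bs D (eSuc c)"
    if "\<exists>m<M. card (Bs m) \<noteq> 1" "s < T"
       "sample_argmin K M W (\<lambda>k m. sqrt 2 * D k m) tt"
       "\<forall>k<K. wcpe_alloc K g M T (tt k) (plays a s0 s k) (d k)"
       "phase K M T a s (wcpe_plays M Bs d)"
       "e = phase_end K M s (wcpe_plays M Bs d)" "e \<le> T"
       "Bs' = wcpe_sets K M W g T a x s0 e Bs"
       "wcpe_loop K M W g T a x s0 e Bs' (wcpe_halve Bs' D) c"

definition wcpe_reg ::
  "nat \<Rightarrow> nat \<Rightarrow> (nat \<Rightarrow> nat \<Rightarrow> real) \<Rightarrow> (real \<Rightarrow> real) \<Rightarrow> nat \<Rightarrow> decisions \<Rightarrow> table \<Rightarrow> nat \<Rightarrow>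
   enat \<Rightarrow> bool" where
  "wcpe_reg K M W g T a x s0 c \<longleftrightarrow>
     phase K M T a s0 (\<lambda>k m. 1) \<and>
     wcpe_loop K M W g T a x s0 (phase_end K M s0 (\<lambda>k m. 1)) (\<lambda>m. {..<K}) (\<lambda>k m. 1) c"

section \<open>The collaborative algorithm\<close>

definition initial_plays :: "nat \<Rightarrow> nat" where
  "initial_plays T = nat \<lceil>sqrt (ln (real T))\<rceil>"

definition clipped_gaps ::
  "nat \<Rightarrow> nat \<Rightarrow> (nat \<Rightarrow> nat \<Rightarrow> real) \<Rightarrow> nat \<Rightarrow> decisions \<Rightarrow> table \<Rightarrow> nat \<Rightarrow> nat \<Rightarrow> nat \<Rightarrow> real" where
  "clipped_gaps K M W T a x t k m =
     min (max (gaps K (mixed_mean M W a x 0 t) k m) (1 / ln (ln (real T)))) (ln (ln (real T)))"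

definition guided_plays ::
  "nat \<Rightarrow> nat \<Rightarrow> (real \<Rightarrow> real) \<Rightarrow> nat \<Rightarrow> (nat \<Rightarrow> nat \<Rightarrow> real) \<Rightarrow> nat \<Rightarrow> nat \<Rightarrow> nat" where
  "guided_plays K M g T q k m =
     max (initial_plays T) (nat \<lceil>18 * q k m * beta K M g (1 / real T) (\<lambda>_. T)\<rceil>)"

definition exploit_condition ::
  "nat \<Rightarrow> nat \<Rightarrow> (nat \<Rightarrow> nat \<Rightarrow> real) \<Rightarrow> (real \<Rightarrow> real) \<Rightarrow> nat \<Rightarrow> decisions \<Rightarrow> table \<Rightarrow> nat \<Rightarrow> bool" where
  "exploit_condition K M W g T a x t \<longleftrightarrow>
     (\<forall>k<K. \<forall>m<M. width K M W g (1 / real T) (plays a 0 t) k m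
                   < ereal (gaps K (mixed_mean M W a x 0 t) k m / 2))"

definition exploitation ::
  "nat \<Rightarrow> nat \<Rightarrow> (nat \<Rightarrow> nat \<Rightarrow> real) \<Rightarrow> nat \<Rightarrow> decisions \<Rightarrow> table \<Rightarrow> nat \<Rightarrow> bool" where
  "exploitation K M W T a x s \<longleftrightarrow>
     (\<forall>m<M. \<exists>k<K. (\<forall>j<K. mixed_mean M W a x 0 s j m \<le> mixed_mean M W a x 0 s k m) \<and>
                    (\<forall>t\<in>{s<..T}. a t m = Some k))"

text \<open>
  \<open>cexp2_run K M W g T a x c\<close>: on the reward table \<open>x\<close>, the decisions \<open>a\<close> up to time \<open>T\<close> are a run of
  CExp\<open>\<^sup>2\<close> with W-CPE-Reg as the policy after a switch, and \<open>c\<close> communication rounds take place.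
\<close>

definition cexp2_run ::
  "nat \<Rightarrow> nat \<Rightarrow> (nat \<Rightarrow> nat \<Rightarrow> real) \<Rightarrow> (real \<Rightarrow> real) \<Rightarrow> nat \<Rightarrow> decisions \<Rightarrow> table \<Rightarrow> enat \<Rightarrow> bool" where
  "cexp2_run K M W g T a x c \<longleftrightarrow>
     (let d_ie = (\<lambda>k m. initial_plays T);
          T_ie = phase_end K M 0 d_ie
      in phase K M T a 0 d_ie \<and>
         (if T < T_ie then c = 0
          else \<exists>q. oracle_argmin K M W (clipped_gaps K M W T a x T_ie) q \<and>
            (let d_ge = (\<lambda>k m. guided_plays K M g T q k m - initial_plays T);
                 T_ge = phase_end K M T_ie d_ge
             in phase K M T a T_ie d_ge \<and>
                (if T < T_ge then c = 1
                 else if exploit_condition K M W g T a x T_ge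
                 then exploitation K M W T a x T_ge \<and> c = 2
                 else \<exists>c'. wcpe_reg K M W g T a x T_ge c' \<and> c = 2 + c'))))"

text \<open>
  An execution on the probability space: a non-anticipating sampling rule, together with its random
  number of communication rounds.
\<close>

definition cexp2_execution ::
  "nat \<Rightarrow> nat \<Rightarrow> (nat \<Rightarrow> nat \<Rightarrow> real) \<Rightarrow> (nat \<Rightarrow> nat \<Rightarrow> real measure) \<Rightarrow> (real \<Rightarrow> real) \<Rightarrow> nat \<Rightarrow>
   (nat \<Rightarrow> nat \<Rightarrow> table \<Rightarrow> nat option) \<Rightarrow> (table \<Rightarrow> enat) \<Rightarrow> bool" where
  "cexp2_execution K M W \<nu> g T a N \<longleftrightarrow>
     non_anticipating K M \<nu> a \<and>
     N \<in> reward_space K M \<nu> \<rightarrow>\<^sub>M count_space UNIV \<and>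
     (\<forall>x\<in>space (reward_space K M \<nu>). cexp2_run K M W g T (\<lambda>t m. a t m x) x (N x))"

end

theory Submission
  imports Defs "HOL-Real_Asymp.Real_Asymp"
begin

text \<open>
  The confidence property of the widths is applied once, to the data collected since time 0, with
  confidence parameter \<open>\<delta> = 1 / (ln T) ^ 3\<close>.  On the resulting event both communication rounds are
  accurate.  After the initial exploration the widths are of order \<open>sqrt (ln (ln T) / sqrt (ln T))\<close>,
  so the estimated gaps are within a small factor of the true ones and are not clipped.
  Hence the guided exploration needs \<open>O(ln T)\<close> plays, and by the constraint of the oracle the widths
  for the smaller parameter \<open>1 / T\<close> are then at most a sixth of the estimated gaps, which forces the
  exploitation condition.

  Off this event no concentration of the data collected after the reset is needed: on every sample
  point W-CPE-Reg takes only \<open>O(ln T)\<close> rounds, because its required precision doubles in each phase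
  and only \<open>T\<close> plays are available.  Multiplied by \<open>\<delta>\<close>, this is at most \<open>1 / ln T\<close>.
\<close>

section \<open>Phases\<close>

lemma plays_add:
  assumes "s \<le> t" "t \<le> u"
  shows "plays a s u k m = plays a s t k m + plays a t u k m"
proof -
  define P where "P I = {i \<in> I. a i m = Some k}" for I
  have "P {s<..u} = P {s<..t} \<union> P {t<..u}" "P {s<..t} \<inter> P {t<..u} = {}"
    using assms by (auto simp: P_def)
  moreover have "finite (P {s<..t})" "finite (P {t<..u})" by (simp_all add: P_def)
  ultimately show ?thesis unfolding plays_def P_def[symmetric] by (simp add: card_Un_disjoint)
qed

lemma plays_le: "plays a s t k m \<le> t - s"
proof -
  have "plays a s t k m \<le> card {s<..t}"
    unfolding plays_def by (rule card_mono) auto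
  then show ?thesis by simp
qed

lemma phase_end_ge:
  assumes "m < M"
  shows "s + (\<Sum>k<K. d k m) \<le> phase_end K M s d"
  unfolding phase_end_def using assms by (intro add_left_mono Max_ge) auto

lemma phase_end_le:
  assumes "1 \<le> M" "\<And>m. m < M \<Longrightarrow> s + (\<Sum>k<K. d k m) \<le> e"
  shows "phase_end K M s d \<le> e"
proof -
  have ne: "(\<lambda>m. \<Sum>k<K. d k m) ` {..<M} \<noteq> {}" "finite ((\<lambda>m. \<Sum>k<K. d k m) ` {..<M})"
    using assms(1) by (auto simp: lessThan_empty_iff)
  have "Max ((\<lambda>m. \<Sum>k<K. d k m) ` {..<M}) \<in> (\<lambda>m. \<Sum>k<K. d k m) ` {..<M}"
    by (rule Max_in[OF ne(2,1)])
  then show ?thesis using assms(2) by (auto simp: phase_end_def)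
qed

text \<open>An agent is busy exactly during its first \<open>S\<close> steps, so its play counts
  have the same sum over the arms as the demands. Being bounded by the demands arm by arm, they must
  coincide with them.\<close>

lemma phase_plays:
  assumes ph: "phase K M T a s d" and e: "phase_end K M s d \<le> T" and "k < K" and m: "m < M"
  shows "plays a s (phase_end K M s d) k m = d k m"
proof -
  define e where "e = phase_end K M s d"
  define S where "S = (\<Sum>k<K. d k m)"
  have le: "s + S \<le> e" unfolding e_def S_def by (rule phase_end_ge[OF m])
  have min: "min T e = e" using e by (simp add: e_def)
  have act: "\<forall>t\<in>{s<..e}. if t \<le> s + S then \<exists>k<K. a t m = Some k else a t m = None"
    and pl: "\<forall>k<K. plays a s e k m \<le> d k m"
    using ph m min unfolding phase_def Let_def e_def[symmetric] by (simp_all add: S_def)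
  have busy: "\<exists>k<K. a t m = Some k" if "s < t" "t \<le> s + S" for t
    using bspec[OF act, of t] le that by simp
  have idle: "a t m = None" if "s + S < t" "t \<le> e" for t
    using bspec[OF act, of t] le that by simp
  have "(\<Sum>k<K. plays a s e k m) = card (\<Union>k\<in>{..<K}. {u \<in> {s<..e}. a u m = Some k})"
    unfolding plays_def by (rule card_UN_disjoint[symmetric]) auto
  also have "(\<Union>k\<in>{..<K}. {u \<in> {s<..e}. a u m = Some k}) = {s<..s + S}"
  proof (intro set_eqI iffI)
    fix t assume t: "t \<in> (\<Union>k\<in>{..<K}. {u \<in> {s<..e}. a u m = Some k})"
    then have "t \<le> s + S" using idle[of t] by (cases "t \<le> s + S") auto
    with t show "t \<in> {s<..s + S}" by auto
  next
    fix t assume "t \<in> {s<..s + S}"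
    with busy[of t] le show "t \<in> (\<Union>k\<in>{..<K}. {u \<in> {s<..e}. a u m = Some k})" by auto
  qed
  finally have "(\<Sum>k<K. plays a s e k m) = (\<Sum>k<K. d k m)" by (simp add: S_def)
  from sum_mono_inv[OF this, of k] show ?thesis
    using pl \<open>k < K\<close> by (simp add: e_def)
qed

section \<open>Feasible allocations\<close>

text \<open>Real division has \<open>x / 0 = 0\<close>, so the real inequality alone loses the
  constraint where \<open>q k n = 0\<close>. There the \<open>ennreal\<close> quotient is infinite
  unless the weight vanishes, which the second claim records.\<close>

lemma feasible_real:
  assumes f: "feasible K M W \<Delta> q" and k: "k < K" and m: "m < M"
  shows "(\<Sum>n<M. (W n m)\<^sup>2 / q k n) \<le> (\<Delta> k m)\<^sup>2 / 2"
    and "\<And>n. n < M \<Longrightarrow> q k n = 0 \<Longrightarrow> W n m = 0"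
proof -
  have le: "(\<Sum>n<M. ennreal ((W n m)\<^sup>2) / ennreal (q k n)) \<le> ennreal ((\<Delta> k m)\<^sup>2 / 2)"
    and nn: "\<And>n. n < M \<Longrightarrow> 0 \<le> q k n"
    using f k m unfolding feasible_def by auto
  have fin: "ennreal ((W n m)\<^sup>2) / ennreal (q k n) \<noteq> \<infinity>" if "n < M" for n
  proof -
    have "ennreal ((W n m)\<^sup>2) / ennreal (q k n) \<le> (\<Sum>n<M. ennreal ((W n m)\<^sup>2) / ennreal (q k n))"
      using that by (intro member_le_sum) auto
    also note le
    finally show ?thesis by (auto simp: top_unique)
  qed
  show z: "W n m = 0" if "n < M" "q k n = 0" for n
  proof (rule ccontr)
    assume "W n m \<noteq> 0"
    with fin[OF that(1)] that(2) show False
      by (simp add: ennreal_divide_zero)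
  qed
  have "ennreal ((W n m)\<^sup>2) / ennreal (q k n) = ennreal ((W n m)\<^sup>2 / q k n)" if "n < M" for n
  proof (cases "q k n = 0")
    case True
    then show ?thesis using z[OF that] by simp
  next
    case False
    then show ?thesis using nn[OF that] by (simp add: divide_ennreal)
  qed
  with le have "(\<Sum>n<M. ennreal ((W n m)\<^sup>2 / q k n)) \<le> ennreal ((\<Delta> k m)\<^sup>2 / 2)"
    by simp
  then show "(\<Sum>n<M. (W n m)\<^sup>2 / q k n) \<le> (\<Delta> k m)\<^sup>2 / 2"
    using nn by (subst (asm) sum_ennreal) (auto simp: ennreal_le_iff)
qed

text \<open>Supplies the competitor against which the optimal value of the oracle is
  bounded.\<close>

lemma feasible_const:
  assumes "0 < c" and "\<And>k m. k < K \<Longrightarrow> m < M \<Longrightarrow> (\<Sum>n<M. (W n m)\<^sup>2) / c \<le> (\<Delta> k m)\<^sup>2 / 2"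
  shows "feasible K M W \<Delta> (\<lambda>_ _. c)"
  unfolding feasible_def
proof (intro allI impI conjI)
  fix k m assume "k < K" "m < M"
  have "(\<Sum>n<M. ennreal ((W n m)\<^sup>2) / ennreal c) = (\<Sum>n<M. ennreal ((W n m)\<^sup>2 / c))"
    using \<open>0 < c\<close> by (simp only: divide_ennreal zero_le_power2)
  also have "\<dots> = ennreal (\<Sum>n<M. (W n m)\<^sup>2 / c)"
    using \<open>0 < c\<close> by (intro sum_ennreal) simp
  also have "\<dots> \<le> ennreal ((\<Delta> k m)\<^sup>2 / 2)"
    using assms(2)[OF \<open>k < K\<close> \<open>m < M\<close>] by (intro ennreal_leI) (simp add: sum_divide_distrib)
  finally show "(\<Sum>n<M. ennreal ((W n m)\<^sup>2) / ennreal c) \<le> ennreal ((\<Delta> k m)\<^sup>2 / 2)" .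
qed (use \<open>0 < c\<close> in simp)

section \<open>Gaps\<close>

text \<open>Both cases of \<open>gap\<close> measure the distance to the best score among the other
  arms. Without the case distinction, perturbation and lower bounds become linear
  arithmetic.\<close>

lemma gap_eq_abs:
  assumes "2 \<le> K" "k < K"
  shows "gap K v k = \<bar>v k - (MAX j\<in>{..<K} - {k}. v j)\<bar>"
proof -
  define A where "A = {..<K} - {k}"
  \<comment> \<open>A second arm, available because \<open>2 \<le> K\<close>; it makes the maximum
    over \<open>A\<close> meaningful.\<close>
  have "(if k = 0 then 1 else 0) \<in> A" using assms by (auto simp: A_def)
  then have A: "finite (v ` A)" "v ` A \<noteq> {}" by (auto simp: A_def)
  have "finite A" by (simp add: A_def)
  obtain b where b: "b \<in> A" "v b = Max (v ` A)" using Max_in[OF A] by auto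
  have le: "v j \<le> v b" if "j \<in> A" for j using that A b by auto
  show ?thesis
  proof (cases "\<forall>j<K. v j \<le> v k")
    case True
    have "(MIN j\<in>A. v k - v j) = v k - v b"
      using A(1) b(1) le by (intro Min_eqI) (auto simp: \<open>finite A\<close>)
    moreover have "v b \<le> v k" using True b(1) by (auto simp: A_def)
    ultimately show ?thesis using True b by (simp add: gap_def A_def[symmetric])
  next
    case False
    then have "v k < v b" using le by (force simp: A_def not_le)
    then have "(MAX j\<in>{..<K}. v j) = v b"
      using b(1) le by (intro Max_eqI) (auto simp: A_def, force)
    then have "gap K v k = v b - v k"
      using False by (simp only: gap_def if_False)
    with \<open>v k < v b\<close> b show ?thesis by (simp add: A_def[symmetric])
  qed
qed

text \<open>In the form of \<open>gap_eq_abs\<close>, the score of \<open>k\<close> and the maximum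
  over the other arms each move by at most \<open>\<epsilon>\<close>.\<close>

lemma gap_perturb:
  assumes "2 \<le> K" "k < K" and uv: "\<And>j. j < K \<Longrightarrow> \<bar>v j - u j\<bar> \<le> \<epsilon>"
  shows "\<bar>gap K v k - gap K u k\<bar> \<le> 2 * \<epsilon>"
proof -
  define A where "A = {..<K} - {k}"
  have "(if k = 0 then 1 else 0) \<in> A" using assms by (auto simp: A_def)
  then have A: "finite A" "A \<noteq> {}" by (auto simp: A_def)
  have *: "Max (f ` A) \<le> Max (h ` A) + \<epsilon>" if "\<And>j. j < K \<Longrightarrow> f j \<le> h j + \<epsilon>" for f h :: "nat \<Rightarrow> real"
  proof -
    have "f j \<le> Max (h ` A) + \<epsilon>" if "j \<in> A" for j
    proof -
      have "h j \<le> Max (h ` A)" using A that by simp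
      moreover have "f j \<le> h j + \<epsilon>" using that \<open>\<And>j. j < K \<Longrightarrow> f j \<le> h j + \<epsilon>\<close> by (auto simp: A_def)
      ultimately show ?thesis by linarith
    qed
    then show ?thesis using A by (simp add: Max_le_iff)
  qed
  have le: "v j \<le> u j + \<epsilon>" "u j \<le> v j + \<epsilon>" if "j < K" for j
    using uv[OF that] by linarith+
  have "Max (v ` A) \<le> Max (u ` A) + \<epsilon>" "Max (u ` A) \<le> Max (v ` A) + \<epsilon>"
    using le by (auto intro!: *)
  with uv[OF assms(2)] show ?thesis
    unfolding gap_eq_abs[OF assms(1,2)] A_def[symmetric] by linarith
qed

text \<open>Identifies \<open>gap\<close> with the suboptimality gap under a unique best arm; the
  strictness of the maximum is what makes the gap of \<open>b\<close> positive.\<close>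

lemma gap_unique_best:
  assumes K: "2 \<le> K" and b: "b < K" "\<forall>j<K. j \<noteq> b \<longrightarrow> u j < u b"
  shows "\<And>j. j < K \<Longrightarrow> j \<noteq> b \<Longrightarrow> gap K u j = u b - u j"
    and "\<And>j. j < K \<Longrightarrow> j \<noteq> b \<Longrightarrow> gap K u b \<le> u b - u j"
    and "0 < gap K u b"
proof -
  have le: "u j \<le> u b" if "j < K" for j using b(2) that by (cases "j = b") auto
  fix j assume j: "j < K" "j \<noteq> b"
  have "(MAX j\<in>{..<K}. u j) = u b" using b(1) le by (intro Max_eqI) auto
  moreover have "\<not> (\<forall>i<K. u i \<le> u j)" using b j by (auto simp: not_le)
  ultimately show "gap K u j = u b - u j" unfolding gap_def by auto
  show "gap K u b \<le> u b - u j"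
    unfolding gap_def using le j by (auto intro!: Min_le)
next
  have le: "u j \<le> u b" if "j < K" for j using b(2) that by (cases "j = b") auto
  have "(if b = 0 then 1 else 0) \<in> {..<K} - {b}" using K b by auto
  then have "{..<K} - {b} \<noteq> {}" by blast
  then show "0 < gap K u b"
    unfolding gap_def using le b by (auto simp: Min_gr_iff)
qed

text \<open>Each error is at most a fifth of its gap, so two of them cost at most 2/5 of
  \<open>u b - u j\<close>. At least 3/5 of the separation survives in \<open>v\<close>, more than
  the 2/5 that twice a width can reach. As \<open>gap\<close> is an absolute value, it suffices to
  bound \<open>v b - v j\<close> from below, whichever arm is empirically best.\<close>

lemma gap_dominates_widths:
  assumes K: "2 \<le> K" and b: "b < K" "\<forall>j<K. j \<noteq> b \<longrightarrow> u j < u b"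
    and uv: "\<And>j. j < K \<Longrightarrow> \<bar>v j - u j\<bar> \<le> w j"
    and w: "\<And>j. j < K \<Longrightarrow> 5 * w j \<le> gap K u j" and k: "k < K"
  shows "2 * w k < gap K v k"
proof -
  note u = gap_unique_best[where u = u, OF K b]
  have sep: "3 * u b - 3 * u j \<le> 5 * v b - 5 * v j" if j: "j < K" "j \<noteq> b" for j
    using uv[OF j(1)] uv[OF b(1)] w[OF j(1)] w[OF b(1)] u(1,2)[OF j] by linarith
  show ?thesis
  proof (cases "k = b")
    case False
    have "v b \<le> (MAX j\<in>{..<K} - {k}. v j)" using b False by (intro Max_ge) auto
    then have "v b - v k \<le> gap K v k" unfolding gap_eq_abs[OF K k] by linarith
    then show ?thesis using sep[OF k False] w[OF k] u(1)[OF k False] b(2) k False by fastforce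
  next
    case True
    have "(if k = 0 then 1 else 0) \<in> {..<K} - {k}" using K k by auto
    then have "(MAX j\<in>{..<K} - {k}. v j) \<in> v ` ({..<K} - {k})" by (intro Max_in) auto
    \<comment> \<open>For the best arm, \<open>j\<close> is its strongest competitor under
      \<open>v\<close>.\<close>
    then obtain j where j: "j < K" "j \<noteq> b" "(MAX j\<in>{..<K} - {k}. v j) = v j" using True by auto
    then have "v b - v j \<le> gap K v k" unfolding True gap_eq_abs[OF K b(1)] by linarith
    then show ?thesis using sep[OF j(1,2)] w[OF k] u(2)[OF j(1,2)] u(3) unfolding True by linarith
  qed
qed

section \<open>Thresholds and widths\<close>

text \<open>Near 0 the ratio in the limit lies between 1/2 and 2. For
  \<open>L = ln (1 / \<delta>) > 1\<close> the comparison function lies between \<open>L\<close> and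
  \<open>(1 + M) * L\<close>, because \<open>0 \<le> ln L \<le> L\<close>.\<close>

lemma threshold_bounds:
  assumes "threshold_function K M W \<nu> g"
  obtains \<delta>0 where "0 < \<delta>0" "\<delta>0 \<le> 1" "\<forall>\<delta>. 0 < \<delta> \<and> \<delta> < \<delta>0 \<longrightarrow>
    ln (1 / \<delta>) / 2 \<le> g \<delta> \<and> g \<delta> \<le> (2 + 2 * real M) * ln (1 / \<delta>)"
proof -
  let ?h = "\<lambda>\<delta>. ln (1 / \<delta>) + real M * ln (ln (1 / \<delta>))"
  have "((\<lambda>\<delta>. g \<delta> / ?h \<delta>) \<longlongrightarrow> 1) (at_right 0)"
    using assms by (simp add: threshold_function_def)
  then have "\<forall>\<^sub>F \<delta> in at_right 0. dist (g \<delta> / ?h \<delta>) 1 < 1 / 2"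
    by (rule tendstoD) simp
  moreover have "\<forall>\<^sub>F \<delta>::real in at_right 0. 1 < ln (1 / \<delta>)"
    by real_asymp
  ultimately have "\<forall>\<^sub>F \<delta> in at_right 0.
      ln (1 / \<delta>) / 2 \<le> g \<delta> \<and> g \<delta> \<le> (2 + 2 * real M) * ln (1 / \<delta>)"
  proof eventually_elim
    case (elim \<delta>)
    define L where "L = ln (1 / \<delta>)"
    have L: "1 < L" using elim(2) by (simp add: L_def)
    have lnL: "0 \<le> ln L" "ln L \<le> L" using L ln_bound[of L] by auto
    have h: "L \<le> ?h \<delta>" "?h \<delta> \<le> (1 + real M) * L"
      using lnL L mult_left_mono[OF lnL(2), of "real M"]
      unfolding L_def[symmetric] by (auto simp: algebra_simps)
    define H where "H = ?h \<delta>"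
    have h: "L \<le> H" "H \<le> (1 + real M) * L" using h by (simp_all add: H_def)
    have "\<bar>g \<delta> / H - 1\<bar> < 1 / 2" using elim(1) by (simp add: dist_real_def H_def)
    then have "1 / 2 \<le> g \<delta> / H" "g \<delta> / H \<le> 2" by linarith+
    then have "1 / 2 * H \<le> g \<delta>" "g \<delta> \<le> 2 * H"
      using h(1) L by (simp_all only: pos_le_divide_eq pos_divide_le_eq)
    then have "L / 2 \<le> g \<delta>" "g \<delta> \<le> (2 + 2 * real M) * L"
      using h by (auto simp: algebra_simps)
    then show ?case unfolding L_def[symmetric] by simp
  qed
  then obtain d where "0 < d" "\<And>\<delta>. 0 < \<delta> \<Longrightarrow> \<delta> < d \<Longrightarrow>
      ln (1 / \<delta>) / 2 \<le> g \<delta> \<and> g \<delta> \<le> (2 + 2 * real M) * ln (1 / \<delta>)"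
    unfolding eventually_at_right_field by auto
  then show ?thesis by (intro that[of "min d 1"]) auto
qed

text \<open>The iterated logarithms are nonnegative at positive counts, so positivity of
  \<open>beta\<close> reduces to that of \<open>g\<close>.\<close>

lemma beta_ge:
  assumes "\<And>m. m < M \<Longrightarrow> 1 \<le> N m"
  shows "2 * g (\<delta> / (real K * real M)) \<le> beta K M g \<delta> N"
proof -
  have "0 \<le> ln (4 + ln (real (N m)))" if "m < M" for m
    using assms[OF that] by (intro ln_ge_zero) (simp add: add_increasing2)
  then have "0 \<le> (\<Sum>m<M. ln (4 + ln (real (N m))))" by (intro sum_nonneg) auto
  then show ?thesis by (simp add: beta_def)
qed

text \<open>Serves two comparisons: actual counts against the horizon at parameter
  \<open>1 / T\<close>, and parameter \<open>\<delta>\<close> against \<open>1 / T\<close> at equal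
  counts.\<close>

lemma beta_mono:
  assumes "\<And>m. m < M \<Longrightarrow> 1 \<le> N m" "\<And>m. m < M \<Longrightarrow> N m \<le> N' m"
    and "g (\<delta> / (real K * real M)) \<le> g (\<delta>' / (real K * real M))"
  shows "beta K M g \<delta> N \<le> beta K M g \<delta>' N'"
proof -
  have "ln (4 + ln (real (N m))) \<le> ln (4 + ln (real (N' m)))" if "m < M" for m
  proof -
    have "0 \<le> ln (real (N m))" "ln (real (N m)) \<le> ln (real (N' m))"
      using assms(1,2)[OF that] by auto
    then show ?thesis by simp
  qed
  then have "(\<Sum>m<M. ln (4 + ln (real (N m)))) \<le> (\<Sum>m<M. ln (4 + ln (real (N' m))))"
    by (intro sum_mono) auto
  then show ?thesis using assms(3) by (simp add: beta_def)
qed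

lemma width_eq:
  assumes "\<And>n. n < M \<Longrightarrow> 1 \<le> \<tau> k n"
  shows "width K M W g \<delta> \<tau> k m =
    ereal (sqrt (beta K M g \<delta> (\<tau> k) * (\<Sum>n<M. (W n m)\<^sup>2 / real (\<tau> k n))))"
  using assms by (force simp: width_def)

lemma width_nonneg:
  assumes "0 \<le> g (\<delta> / (real K * real M))"
  shows "0 \<le> width K M W g \<delta> \<tau> k m"
proof (cases "\<exists>n<M. \<tau> k n = 0")
  case False
  then have \<tau>: "1 \<le> \<tau> k n" if "n < M" for n using that by (simp add: Suc_le_eq)
  have "0 \<le> beta K M g \<delta> (\<tau> k)"
    using beta_ge[of M "\<tau> k" g \<delta> K] \<tau> assms by force
  then show ?thesis
    using width_eq[of M \<tau> k K W g \<delta> m] \<tau> by (auto intro!: mult_nonneg_nonneg sum_nonneg)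
qed (auto simp: width_def)

section \<open>Rounds of W-CPE-Reg\<close>

lemma wcpe_sets_subset: "wcpe_sets K M W g T a x s0 e Bs m \<subseteq> Bs m"
  by (auto simp: wcpe_sets_def Let_def)

text \<open>The arm with the largest lower confidence bound passes its own test, because widths are
  nonnegative.\<close>

lemma wcpe_sets_nonempty:
  assumes fin: "finite (Bs m)" and ne: "Bs m \<noteq> {}" and g: "0 \<le> g (1 / real T / (real K * real M))"
  shows "wcpe_sets K M W g T a x s0 e Bs m \<noteq> {}"
proof -
  define mu where "mu k = ereal (mixed_mean M W a x s0 e k m)" for k
  define om where "om k = width K M W g (1 / real T) (plays a s0 e) k m" for k
  have "Max ((\<lambda>j. mu j - om j) ` Bs m) \<in> (\<lambda>j. mu j - om j) ` Bs m"
    using fin ne by (intro Max_in) auto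
  then obtain j where j: "j \<in> Bs m" "(MAX j\<in>Bs m. mu j - om j) = mu j - om j" by auto
  have "0 \<le> om j" unfolding om_def using width_nonneg[of g "1 / real T" K M] g by blast
  then have "mu j - om j \<le> mu j + om j"
    unfolding mu_def by (cases "om j") auto
  with j have "j \<in> wcpe_sets K M W g T a x s0 e Bs m"
    unfolding wcpe_sets_def Let_def mu_def om_def by simp
  then show ?thesis by blast
qed

text \<open>The weights for agent \<open>m\<close> sum to 1, so some \<open>n\<close> has weight at
  least \<open>1 / M\<close>, and its term alone in the constraint forces \<open>q k n\<close> to be
  large. The product form avoids dividing by \<open>\<Delta>\<close>.\<close>

lemma feasible_lower_bound:
  assumes f: "feasible K M W \<Delta> q" and "k < K" "m < M" and W: "(\<Sum>n<M. W n m) = 1"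
  obtains n where "n < M" "2 \<le> (real M)\<^sup>2 * (\<Delta> k m)\<^sup>2 * q k n"
proof -
  have "\<exists>n<M. 1 / real M \<le> W n m"
  proof (rule ccontr)
    assume "\<not> ?thesis"
    then have "(\<Sum>n<M. W n m) < (\<Sum>n<M. 1 / real M)"
      using \<open>m < M\<close> by (intro sum_strict_mono) (auto simp: not_le)
    with W \<open>m < M\<close> show False by simp
  qed
  then obtain n where n: "n < M" "1 / real M \<le> W n m" by blast
  have M: "0 < real M" using \<open>m < M\<close> by simp
  have q0: "0 \<le> q k i" if "i < M" for i using f \<open>k < K\<close> that by (auto simp: feasible_def)
  have "0 < W n m" using n M by (meson less_le_trans divide_pos_pos zero_less_one)
  then have q: "0 < q k n"
    using feasible_real(2)[OF f \<open>k < K\<close> \<open>m < M\<close> n(1)] q0[OF n(1)] by fastforce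
  have "(W n m)\<^sup>2 / q k n \<le> (\<Sum>n<M. (W n m)\<^sup>2 / q k n)"
    using n q0 by (intro member_le_sum) auto
  also have "\<dots> \<le> (\<Delta> k m)\<^sup>2 / 2" by (rule feasible_real(1)[OF f \<open>k < K\<close> \<open>m < M\<close>])
  finally have 1: "2 * (W n m)\<^sup>2 \<le> (\<Delta> k m)\<^sup>2 * q k n" using q by (simp add: field_simps)
  have "1 \<le> (real M * W n m)\<^sup>2"
    using n M by (intro one_le_power) (simp add: field_simps)
  then have "2 \<le> (real M)\<^sup>2 * (2 * (W n m)\<^sup>2)" by (simp add: power_mult_distrib)
  also have "\<dots> \<le> (real M)\<^sup>2 * ((\<Delta> k m)\<^sup>2 * q k n)" using 1 by (rule mult_left_mono) simp
  finally show ?thesis using that n by (simp add: mult.assoc)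
qed

text \<open>
  While an arm stays active, its parameter is halved in every phase, so completing phase \<open>r\<close> takes
  at least \<open>4 ^ r / M\<^sup>2\<close> plays by some agent, and only \<open>T\<close> are available.
\<close>

lemma wcpe_loop_rounds:
  assumes W: "\<forall>m<M. (\<Sum>n<M. W n m) = 1"
    and g: "1 \<le> g (1 / real T / (real K * real M))"
    and R: "(real M)\<^sup>2 * real T < 4 ^ R"
    and "wcpe_loop K M W g T a x s0 s Bs D c" "s0 \<le> s"
    and "\<forall>m<M. Bs m \<subseteq> {..<K} \<and> Bs m \<noteq> {}"
    and "\<forall>m<M. \<forall>k\<in>Bs m. 1 < card (Bs m) \<longrightarrow> 0 \<le> D k m \<and> D k m \<le> (1 / 2) ^ r"
    and "\<forall>k<K. \<forall>m<M. 1 \<le> plays a s0 s k m"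
  shows "c \<le> enat (R - r)"
  using assms(4-)
\<comment> \<open>A coinductive predicate offers no rule induction. The run is unfolded one phase at
  a time while \<open>R - r\<close> decreases, which also rules out infinitely many rounds.\<close>
proof (induction "R - r" arbitrary: s Bs D c r rule: less_induct)
  case less
  note Bs = less.prems(3) and D = less.prems(4) and pl = less.prems(5)
  from less.prems(1) show ?case
  proof cases
    case (phase_completed tt d e Bs' c')
    let ?d = "wcpe_plays M Bs d"
    have fin: "finite (Bs m)" if "m < M" for m using Bs that finite_subset by blast
    \<comment> \<open>The loop has not stopped, so some agent still has at least two arms; the
      parameter of such an arm has been halved in all \<open>r\<close> earlier phases.\<close>
    obtain m where m: "m < M" "card (Bs m) \<noteq> 1" using phase_completed by blast
    moreover have "card (Bs m) \<noteq> 0" using Bs fin[OF m(1)] m(1) by simp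
    ultimately have "1 < card (Bs m)" by linarith
    obtain k where k: "k \<in> Bs m" "k < K" using Bs m(1) by blast
    have Dk: "0 \<le> D k m" "D k m \<le> (1 / 2) ^ r" using D m(1) k(1) \<open>1 < card (Bs m)\<close> by auto
    have "s \<le> e" using phase_completed by (simp add: phase_end_def)
    have "feasible K M W (\<lambda>k m. sqrt 2 * D k m) tt"
      using phase_completed unfolding sample_argmin_def is_arg_min_def by blast
    \<comment> \<open>Squaring \<open>sqrt 2\<close> cancels the 2 of the lower bound. The agent
      \<open>n\<close> found here may differ from \<open>m\<close>.\<close>
    from feasible_lower_bound[OF this k(2) m(1)] W m(1)
    obtain n where n: "n < M" "1 \<le> (real M)\<^sup>2 * (D k m)\<^sup>2 * tt k n"
      by (auto simp: power_mult_distrib mult.assoc)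
    let ?N = "\<lambda>i. plays a s0 s k i + d k i"
    have "1 \<le> ?N i" if "i < M" for i using pl k(2) that by (simp add: trans_le_add1)
    then have beta: "1 \<le> beta K M g (1 / real T) ?N"
      using beta_ge[of M ?N g "1 / real T" K] g by fastforce
    \<comment> \<open>The allocation rule bounds the ratio of plays to \<open>beta\<close> from
      below by \<open>tt k n\<close>; since \<open>beta \<ge> 1\<close>, the number of plays itself
      is at least \<open>tt k n\<close>.\<close>
    have "tt k n \<le> real (?N n) / beta K M g (1 / real T) ?N"
      using phase_completed k(2) n(1) unfolding wcpe_alloc_def is_arg_min_def by blast
    also have "\<dots> \<le> real (?N n)" using beta divide_left_mono[of 1 _ "real (?N n)"] by simp
    \<comment> \<open>Arm \<open>k\<close> is active for agent \<open>m\<close>, hence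
      \<open>wcpe_plays\<close> makes every agent play it, including an \<open>n\<close> that has
      discarded it.\<close>
    also have "?N n = plays a s0 e k n"
      using phase_plays[of K M T a s ?d k n] phase_completed k m(1) n(1)
        plays_add[OF \<open>s0 \<le> s\<close> \<open>s \<le> e\<close>, of a k n] by (auto simp: wcpe_plays_def)
    also have "real (plays a s0 e k n) \<le> real T"
      using plays_le[of a s0 e k n] \<open>e \<le> T\<close> by linarith
    finally have tt: "tt k n \<le> real T" .
    have "(D k m)\<^sup>2 \<le> ((1 / 2) ^ r)\<^sup>2" using Dk by (rule power_mono[rotated])
    also have "\<dots> = (1 / 4) ^ r" by (simp add: power2_eq_square flip: power_mult_distrib)
    finally have D2: "(D k m)\<^sup>2 \<le> (1 / 4) ^ r" .
    have "1 \<le> (real M)\<^sup>2 * (D k m)\<^sup>2 * tt k n" by (rule n(2))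
    also have "\<dots> \<le> (real M)\<^sup>2 * (D k m)\<^sup>2 * real T" by (intro mult_left_mono tt) simp
    also have "\<dots> \<le> (real M)\<^sup>2 * (1 / 4) ^ r * real T"
      by (intro mult_right_mono mult_left_mono D2) auto
    finally have "4 ^ r \<le> (real M)\<^sup>2 * real T" by (simp add: power_one_over field_simps)
    with R have "(4::real) ^ r < 4 ^ R" by linarith
    then have r: "r < R" by simp
    have sub: "Bs' i \<subseteq> Bs i" for i using phase_completed wcpe_sets_subset by simp
    have "c' \<le> enat (R - Suc r)"
    proof (rule less.hyps)
      show "R - Suc r < R - r" using r by simp
      show "wcpe_loop K M W g T a x s0 e Bs' (wcpe_halve Bs' D) c'" using phase_completed by blast
      show "s0 \<le> e" using \<open>s0 \<le> s\<close> \<open>s \<le> e\<close> by simp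
      show "\<forall>m<M. Bs' m \<subseteq> {..<K} \<and> Bs' m \<noteq> {}"
        using sub Bs fin wcpe_sets_nonempty g phase_completed by (metis order_trans zero_le_one)
      show "\<forall>k<K. \<forall>m<M. 1 \<le> plays a s0 e k m"
        using pl plays_add[OF \<open>s0 \<le> s\<close> \<open>s \<le> e\<close>] by (simp add: trans_le_add1)
      \<comment> \<open>\<open>wcpe_halve\<close> refers to the updated sets, so exactly the arms
        covered by the invariant have just been halved.\<close>
      show "\<forall>m<M. \<forall>k\<in>Bs' m. 1 < card (Bs' m) \<longrightarrow>
          0 \<le> wcpe_halve Bs' D k m \<and> wcpe_halve Bs' D k m \<le> (1 / 2) ^ Suc r"
      proof (intro allI impI ballI)
        fix i j assume i: "i < M" "j \<in> Bs' i" "1 < card (Bs' i)"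
        then have "1 < card (Bs i)" using card_mono[OF fin sub] by (meson less_le_trans)
        then have "0 \<le> D j i \<and> D j i \<le> (1 / 2) ^ r" using D i sub by blast
        then show "0 \<le> wcpe_halve Bs' D j i \<and> wcpe_halve Bs' D j i \<le> (1 / 2) ^ Suc r"
          using i by (simp add: wcpe_halve_def)
      qed
    qed
    then have "eSuc c' \<le> eSuc (enat (R - Suc r))" by simp
    also have "\<dots> = enat (R - r)" using r by (simp add: eSuc_enat Suc_diff_Suc)
    finally show ?thesis using phase_completed by simp
  qed (simp_all add: zero_enat_def)
qed

lemma wcpe_reg_rounds:
  assumes K: "2 \<le> K" and M: "1 \<le> M" and W: "\<forall>m<M. (\<Sum>n<M. W n m) = 1"
    and g: "1 \<le> g (1 / real T / (real K * real M))"
    and R: "(real M)\<^sup>2 * real T < 4 ^ R"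
    and run: "wcpe_reg K M W g T a x s0 c"
  shows "c \<le> enat R"
proof -
  define s where "s = phase_end K M s0 (\<lambda>k m. 1)"
  have ph: "phase K M T a s0 (\<lambda>k m. 1)"
    and loop: "wcpe_loop K M W g T a x s0 s (\<lambda>m. {..<K}) (\<lambda>k m. 1) c"
    using run by (auto simp: wcpe_reg_def s_def)
  show ?thesis
  proof (cases "s \<le> T")
    case True
    have "s0 \<le> s" by (simp add: s_def phase_end_def)
    have "plays a s0 s k m = 1" if "k < K" "m < M" for k m
      using phase_plays[OF ph _ that] True by (simp add: s_def)
    then have "c \<le> enat (R - 0)"
      using K by (intro wcpe_loop_rounds[where g = g, OF W g R loop \<open>s0 \<le> s\<close>]) (auto simp: lessThan_empty_iff)
    then show ?thesis by simp
  next
    case False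
    \<comment> \<open>The untruncated end of the first phase lies beyond \<open>T\<close>, so no
      phase of the loop can start.\<close>
    from loop have "c = 0" using False by cases auto
    then show ?thesis by (simp add: zero_enat_def)
  qed
qed

lemma cexp2_run_rounds:
  assumes "2 \<le> K" "1 \<le> M" "\<forall>m<M. (\<Sum>n<M. W n m) = 1"
    and "1 \<le> g (1 / real T / (real K * real M))"
    and "(real M)\<^sup>2 * real T < 4 ^ R"
    and run: "cexp2_run K M W g T a x c"
  shows "c \<le> 2 + enat R"
proof -
  have "c = 0 \<or> c = 1 \<or> c = 2 \<or> (\<exists>s c'. wcpe_reg K M W g T a x s c' \<and> c = 2 + c')"
    using run unfolding cexp2_run_def Let_def by (auto split: if_splits)
  then consider "c \<le> 2" | s c' where "wcpe_reg K M W g T a x s c'" "c = 2 + c'"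
    by (auto simp: one_le_numeral)
  then show ?thesis
  proof cases
    case 1
    then show ?thesis by (simp add: add_increasing2)
  next
    case 2
    then show ?thesis
      using wcpe_reg_rounds[where g = g, OF assms(1-5)] by (simp add: add_left_mono)
  qed
qed

text \<open>The constant allocation \<open>c = 2 * M / lo^2\<close> is feasible, as the squared
  weights sum to at most \<open>M\<close>. Optimality bounds the whole objective by
  \<open>K * M * c * hi\<close>, and a single summand is at least \<open>q k m * lo\<close>.\<close>

lemma oracle_argmin_le:
  assumes W: "\<forall>n<M. \<forall>m<M. 0 \<le> W n m \<and> W n m \<le> 1"
    and lo: "0 < lo" and \<Delta>: "\<And>k m. k < K \<Longrightarrow> m < M \<Longrightarrow> lo \<le> \<Delta> k m \<and> \<Delta> k m \<le> hi"
    and q: "oracle_argmin K M W \<Delta> q" and k: "k < K" and m: "m < M"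
  shows "q k m \<le> 2 * real K * (real M)\<^sup>2 * hi / lo ^ 3"
proof -
  define c where "c = 2 * real M / lo\<^sup>2"
  have c: "0 < c" using lo m by (simp add: c_def)
  have "feasible K M W \<Delta> (\<lambda>_ _. c)"
  proof (rule feasible_const[OF c])
    fix k m assume km: "k < K" "m < M"
    have "(\<Sum>n<M. (W n m)\<^sup>2) \<le> (\<Sum>n<M. 1)"
      using W km by (intro sum_mono) (simp add: power_le_one)
    then have "(\<Sum>n<M. (W n m)\<^sup>2) / c \<le> real M / c" using c by (simp add: divide_right_mono)
    also have "\<dots> = lo\<^sup>2 / 2" using km lo by (simp add: c_def)
    also have "\<dots> \<le> (\<Delta> k m)\<^sup>2 / 2" using \<Delta>[OF km] lo by (simp add: power_mono)
    finally show "(\<Sum>n<M. (W n m)\<^sup>2) / c \<le> (\<Delta> k m)\<^sup>2 / 2" .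
  qed
  then have opt: "(\<Sum>k<K. \<Sum>m<M. q k m * \<Delta> k m) \<le> (\<Sum>k<K. \<Sum>m<M. c * \<Delta> k m)"
    using q unfolding oracle_argmin_def is_arg_min_linorder by blast
  have q0: "0 \<le> q i j" if "i < K" "j < M" for i j
    using q that unfolding oracle_argmin_def is_arg_min_def feasible_def by blast
  have \<Delta>0: "0 \<le> \<Delta> i j" if "i < K" "j < M" for i j using \<Delta>[OF that] lo by linarith
  have "q k m * lo \<le> q k m * \<Delta> k m" using \<Delta>[OF k m] q0[OF k m] by (intro mult_left_mono) auto
  also have "\<dots> \<le> (\<Sum>m<M. q k m * \<Delta> k m)"
    using m k q0 \<Delta>0 by (intro member_le_sum) auto
  also have "\<dots> \<le> (\<Sum>k<K. \<Sum>m<M. q k m * \<Delta> k m)"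
    using k q0 \<Delta>0 by (intro member_le_sum[of k "{..<K}" "\<lambda>k. \<Sum>m<M. q k m * \<Delta> k m"]) (auto intro!: sum_nonneg)
  also note opt
  also have "(\<Sum>k<K. \<Sum>m<M. c * \<Delta> k m) \<le> (\<Sum>k<K. \<Sum>m<M. c * hi)"
    using \<Delta> c by (intro sum_mono mult_left_mono) auto
  also have "\<dots> = real K * real M * c * hi" by simp
  finally have "q k m \<le> real K * real M * c * hi / lo" using lo by (simp add: field_simps)
  also have "\<dots> = 2 * real K * (real M)\<^sup>2 * hi / lo ^ 3"
    using lo by (simp add: c_def power2_eq_square power3_eq_cube)
  finally show ?thesis .
qed

section \<open>Runs with two rounds\<close>

text \<open>Explains the factor 18: with counts of at least \<open>18 * q * B\<close>, the weighted
  sum is at most \<open>1 / (18 * B)\<close> times the constraint value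
  \<open>\<Delta>^2 / 2\<close>. Multiplying by \<open>b \<le> B\<close> leaves
  \<open>\<Delta>^2 / 36\<close>.\<close>

lemma exploit_width:
  assumes f: "feasible K M W \<Delta> q" and k: "k < K" and m: "m < M" and \<Delta>: "0 \<le> \<Delta> k m"
    and B: "0 < B" and b: "0 \<le> b" "b \<le> B"
    and \<tau>: "\<And>n. n < M \<Longrightarrow> 1 \<le> \<tau> n \<and> 18 * q k n * B \<le> real (\<tau> n)"
  shows "sqrt (b * (\<Sum>n<M. (W n m)\<^sup>2 / real (\<tau> n))) \<le> \<Delta> k m / 6"
proof (rule real_le_lsqrt)
  have q0: "0 \<le> q k n" if "n < M" for n using f k that by (auto simp: feasible_def)
  have le: "(W n m)\<^sup>2 / real (\<tau> n) \<le> (W n m)\<^sup>2 / q k n / (18 * B)" if n: "n < M" for n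
  proof (cases "q k n = 0")
    \<comment> \<open>The right side is 0 by the convention for real division; the left side is 0
      because the weight vanishes.\<close>
    case True
    then show ?thesis using feasible_real(2)[OF f k m n] by simp
  next
    case False
    then have "0 < 18 * q k n * B" using q0[OF n] B by simp
    then have "(W n m)\<^sup>2 / real (\<tau> n) \<le> (W n m)\<^sup>2 / (18 * q k n * B)"
      using \<tau>[OF n] by (intro divide_left_mono) auto
    then show ?thesis by (simp add: mult.assoc mult.left_commute)
  qed
  let ?S = "\<Sum>n<M. (W n m)\<^sup>2 / real (\<tau> n)"
  have S0: "0 \<le> ?S" by (intro sum_nonneg) simp
  have "?S \<le> (\<Sum>n<M. (W n m)\<^sup>2 / q k n / (18 * B))" using le by (intro sum_mono) auto
  also have "\<dots> = (\<Sum>n<M. (W n m)\<^sup>2 / q k n) / (18 * B)" by (simp add: sum_divide_distrib)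
  also have "\<dots> \<le> (\<Delta> k m)\<^sup>2 / 2 / (18 * B)"
    using feasible_real(1)[OF f k m] B by (intro divide_right_mono) auto
  finally have "B * ?S \<le> (\<Delta> k m / 6)\<^sup>2" using B by (simp add: field_simps power2_eq_square)
  moreover have "b * ?S \<le> B * ?S" using b S0 by (intro mult_right_mono)
  ultimately show "b * ?S \<le> (\<Delta> k m / 6)\<^sup>2" by linarith
  show "0 \<le> \<Delta> k m / 6" using \<Delta> by simp
qed

text \<open>The deterministic core, for one reward table on which the confidence bounds at parameter
  \<open>\<delta>\<close> hold. \<open>lo\<close> and \<open>hi\<close> enclose the true gaps with
  enough slack that the estimates are not clipped; the last hypothesis leaves room for both
  exploration phases.\<close>

lemma cexp2_run_two_rounds:
  fixes M K T :: nat and g :: "real \<Rightarrow> real"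
  defines "\<tau>1 \<equiv> initial_plays T" and "B \<equiv> beta K M g (1 / real T) (\<lambda>_. T)"
  assumes K: "2 \<le> K" and M: "1 \<le> M" and "1 \<le> T"
    and W: "\<forall>n<M. \<forall>m<M. 0 \<le> W n m \<and> W n m \<le> 1"
    and best: "\<forall>m<M. \<exists>b<K. \<forall>j<K. j \<noteq> b \<longrightarrow> \<mu> j m < \<mu> b m"
    and run: "cexp2_run K M W g T a x c"
    and good: "\<forall>t. \<forall>k<K. \<forall>m<M. ereal \<bar>mixed_mean M W a x 0 t k m - \<mu> k m\<bar>
                 \<le> width K M W g \<delta> (plays a 0 t) k m"
    and g: "0 \<le> g (\<delta> / (real K * real M))"
      "g (\<delta> / (real K * real M)) \<le> g (1 / real T / (real K * real M))"
      "0 < g (1 / real T / (real K * real M))"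
    and \<tau>1: "1 \<le> \<tau>1"
    and \<epsilon>: "beta K M g \<delta> (\<lambda>_. \<tau>1) * real M / real \<tau>1 \<le> \<epsilon>\<^sup>2" "0 \<le> \<epsilon>"
    and gaps: "\<forall>k<K. \<forall>m<M. 5 * lo \<le> 4 * gaps K \<mu> k m \<and> 6 * gaps K \<mu> k m \<le> 5 * hi"
    and lo: "8 * \<epsilon> \<le> lo" "1 / ln (ln (real T)) \<le> lo" "0 < lo" and hi: "hi \<le> ln (ln (real T))"
    and T: "real K * real \<tau>1 + real K * (18 * (2 * real K * (real M)\<^sup>2 * hi / lo ^ 3) * B + 1) \<le> real T"
  shows "c = 2"
proof -
  have gaps': "5 * lo \<le> 4 * gaps K \<mu> k m \<and> 6 * gaps K \<mu> k m \<le> 5 * hi" if "k < K" "m < M" for k m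
    using gaps that by blast
  define Tie where "Tie = phase_end K M 0 (\<lambda>k m. \<tau>1)"
  define \<Delta> where "\<Delta> = clipped_gaps K M W T a x Tie"
  define ie where "ie = mixed_mean M W a x 0 Tie"
  have B: "0 < B"
    using beta_ge[of M "\<lambda>_. T" g "1 / real T" K] g(3) \<open>1 \<le> T\<close> by (simp add: B_def)
  have hi0: "0 \<le> hi" using gaps'[of 0 0] K M lo(3) by linarith
  have Q0: "0 \<le> 18 * (2 * real K * (real M)\<^sup>2 * hi / lo ^ 3) * B"
    using hi0 lo(3) B by simp
  have Tie: "Tie = K * \<tau>1"
    using M by (simp add: Tie_def phase_end_def lessThan_empty_iff image_constant_conv)
  have "real Tie \<le> real T"
  proof -
    have "0 \<le> real K * (18 * (2 * real K * (real M)\<^sup>2 * hi / lo ^ 3) * B + 1)"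
      using Q0 by (intro mult_nonneg_nonneg) auto
    then show ?thesis using T unfolding Tie of_nat_mult by linarith
  qed
  then have TieT: "Tie \<le> T" by simp
  have ph1: "phase K M T a 0 (\<lambda>k m. \<tau>1)"
    and run1: "\<exists>q. oracle_argmin K M W \<Delta> q \<and>
            (let d_ge = (\<lambda>k m. guided_plays K M g T q k m - \<tau>1);
                 T_ge = phase_end K M Tie d_ge
             in phase K M T a Tie d_ge \<and>
                (if T < T_ge then c = 1
                 else if exploit_condition K M W g T a x T_ge
                 then exploitation K M W T a x T_ge \<and> c = 2
                 else \<exists>c'. wcpe_reg K M W g T a x T_ge c' \<and> c = 2 + c'))"
    using run TieT unfolding cexp2_run_def Let_def \<tau>1_def[symmetric] Tie_def[symmetric] \<Delta>_def by auto
  have pl1: "plays a 0 Tie k m = \<tau>1" if "k < K" "m < M" for k m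
    using phase_plays[OF ph1 _ that] TieT by (simp add: Tie_def)
  \<comment> \<open>All counts equal \<open>\<tau>1\<close> and the squared weights sum to at most
    \<open>M\<close>, so the width is at most \<open>\<epsilon>\<close>.\<close>
  have dev1: "\<bar>ie k m - \<mu> k m\<bar> \<le> \<epsilon>" if k: "k < K" and m: "m < M" for k m
  proof -
    have "ereal \<bar>ie k m - \<mu> k m\<bar> \<le> width K M W g \<delta> (plays a 0 Tie) k m"
      using good k m by (simp add: ie_def)
    also have "\<dots> = ereal (sqrt (beta K M g \<delta> (plays a 0 Tie k) * (\<Sum>n<M. (W n m)\<^sup>2 / real (plays a 0 Tie k n))))"
      using pl1[OF k] \<tau>1 by (intro width_eq) simp
    also have "beta K M g \<delta> (plays a 0 Tie k) = beta K M g \<delta> (\<lambda>_. \<tau>1)"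
      using pl1[OF k] by (simp add: beta_def)
    also have "(\<Sum>n<M. (W n m)\<^sup>2 / real (plays a 0 Tie k n)) = (\<Sum>n<M. (W n m)\<^sup>2) / real \<tau>1"
      using pl1[OF k] by (simp add: sum_divide_distrib)
    finally have 1: "\<bar>ie k m - \<mu> k m\<bar> \<le> sqrt (beta K M g \<delta> (\<lambda>_. \<tau>1) * ((\<Sum>n<M. (W n m)\<^sup>2) / real \<tau>1))"
      by simp
    have "0 \<le> beta K M g \<delta> (\<lambda>_. \<tau>1)"
      using beta_ge[of M "\<lambda>_. \<tau>1" g \<delta> K] g(1) \<tau>1 by simp
    moreover have "(\<Sum>n<M. (W n m)\<^sup>2) \<le> (\<Sum>n<M. 1)"
      using W m by (intro sum_mono) (simp add: power_le_one)
    ultimately have "beta K M g \<delta> (\<lambda>_. \<tau>1) * ((\<Sum>n<M. (W n m)\<^sup>2) / real \<tau>1)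
        \<le> beta K M g \<delta> (\<lambda>_. \<tau>1) * (real M / real \<tau>1)"
      by (intro mult_left_mono divide_right_mono) auto
    also have "\<dots> \<le> \<epsilon>\<^sup>2" using \<epsilon>(1) by simp
    finally have "sqrt (beta K M g \<delta> (\<lambda>_. \<tau>1) * ((\<Sum>n<M. (W n m)\<^sup>2) / real \<tau>1)) \<le> \<epsilon>"
      using \<epsilon>(2) real_le_lsqrt by blast
    with 1 show ?thesis by linarith
  qed
  \<comment> \<open>A gap estimate is off by at most \<open>2 * \<epsilon> \<le> lo / 4\<close>,
    which is at most a fifth of the true gap. It thus lies between \<open>lo\<close> and 6/5 of the
    true gap, hence inside the clipping range.\<close>
  have clip: "lo \<le> \<Delta> k m \<and> \<Delta> k m \<le> hi \<and> 5 * \<Delta> k m \<le> 6 * gaps K \<mu> k m"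
    if k: "k < K" and m: "m < M" for k m
  proof -
    have "\<bar>gaps K ie k m - gaps K \<mu> k m\<bar> \<le> 2 * \<epsilon>"
      using dev1 m by (intro gap_perturb[OF K k]) auto
    then have "lo \<le> gaps K ie k m" "gaps K ie k m \<le> hi" "5 * gaps K ie k m \<le> 6 * gaps K \<mu> k m"
      using gaps'[OF k m] lo(1) by linarith+
    moreover from this have "\<Delta> k m = gaps K ie k m"
      using lo(2) hi by (simp add: \<Delta>_def clipped_gaps_def ie_def)
    ultimately show ?thesis by simp
  qed
  obtain q where q: "oracle_argmin K M W \<Delta> q"
    and run2: "let d_ge = (\<lambda>k m. guided_plays K M g T q k m - \<tau>1);
                 T_ge = phase_end K M Tie d_ge
             in phase K M T a Tie d_ge \<and>
                (if T < T_ge then c = 1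
                 else if exploit_condition K M W g T a x T_ge
                 then exploitation K M W T a x T_ge \<and> c = 2
                 else \<exists>c'. wcpe_reg K M W g T a x T_ge c' \<and> c = 2 + c')"
    using run1 by blast
  define Q where "Q = 2 * real K * (real M)\<^sup>2 * hi / lo ^ 3"
  have qQ: "q k m \<le> Q" if "k < K" "m < M" for k m
    unfolding Q_def using clip by (intro oracle_argmin_le[OF W lo(3) _ q that]) auto
  define dge where "dge = (\<lambda>k m. guided_plays K M g T q k m - \<tau>1)"
  define Tge where "Tge = phase_end K M Tie dge"
  have ph2: "phase K M T a Tie dge"
    and run3: "if T < Tge then c = 1
                 else if exploit_condition K M W g T a x Tge
                 then exploitation K M W T a x Tge \<and> c = 2
                 else \<exists>c'. wcpe_reg K M W g T a x Tge c' \<and> c = 2 + c'"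
    using run2 unfolding Let_def dge_def[symmetric] Tge_def[symmetric] by auto
  \<comment> \<open>The summand 1 pays for the ceiling.\<close>
  have dge: "real (dge k m) \<le> 18 * Q * B + 1" if "k < K" "m < M" for k m
  proof -
    have "18 * q k m * B \<le> 18 * Q * B" using qQ[OF that] B by (intro mult_right_mono mult_left_mono) auto
    then have "real (nat \<lceil>18 * q k m * B\<rceil>) \<le> 18 * Q * B + 1"
      using Q0 unfolding Q_def[symmetric] by linarith
    moreover have "dge k m \<le> nat \<lceil>18 * q k m * B\<rceil>"
      unfolding dge_def guided_plays_def B_def \<tau>1_def by simp
    ultimately show ?thesis by linarith
  qed
  have TgeT: "Tge \<le> T"
    unfolding Tge_def
  proof (rule phase_end_le[OF M])
    fix m assume m: "m < M"
    have "real (\<Sum>k<K. dge k m) \<le> (\<Sum>k<K. 18 * Q * B + 1)"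
      unfolding of_nat_sum using dge m by (intro sum_mono) auto
    also have "\<dots> = real K * (18 * Q * B + 1)" by simp
    finally have "real (Tie + (\<Sum>k<K. dge k m)) \<le> real T"
      using T unfolding Tie Q_def by simp
    then show "Tie + (\<Sum>k<K. dge k m) \<le> T" by linarith
  qed
  have "Tie \<le> Tge" by (simp add: Tge_def phase_end_def)
  \<comment> \<open>\<open>guided_plays\<close> is at least \<open>\<tau>1\<close>, so the truncated
    subtraction in \<open>dge\<close> loses nothing and both phases add up.\<close>
  have pl2: "plays a 0 Tge k m = guided_plays K M g T q k m" if "k < K" "m < M" for k m
  proof -
    have "plays a Tie Tge k m = dge k m"
      using phase_plays[OF ph2 _ that] TgeT by (simp add: Tge_def)
    then show ?thesis
      using plays_add[of 0 Tie Tge a k m] \<open>Tie \<le> Tge\<close> pl1[OF that]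
      by (simp add: dge_def guided_plays_def \<tau>1_def)
  qed
  have pl1': "1 \<le> plays a 0 Tge k m" "18 * q k m * B \<le> real (plays a 0 Tge k m)" if "k < K" "m < M" for k m
    unfolding pl2[OF that] using \<tau>1 unfolding guided_plays_def \<tau>1_def[symmetric] B_def by linarith+
  have f: "feasible K M W \<Delta> q" using q by (simp add: oracle_argmin_def is_arg_min_def)
  define w where "w k m = sqrt (beta K M g (1 / real T) (plays a 0 Tge k) *
      (\<Sum>n<M. (W n m)\<^sup>2 / real (plays a 0 Tge k n)))" for k m
  have weq: "width K M W g (1 / real T) (plays a 0 Tge) k m = ereal (w k m)" if "k < K" for k m
    unfolding w_def using pl1'(1)[OF that] by (intro width_eq) auto
  have w\<Delta>: "w k m \<le> \<Delta> k m / 6" if k: "k < K" and m: "m < M" for k m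
    unfolding w_def
  proof (rule exploit_width[OF f k m _ B])
    show "0 \<le> \<Delta> k m" using clip[OF k m] lo(3) by linarith
    show "0 \<le> beta K M g (1 / real T) (plays a 0 Tge k)"
      using beta_ge[of M "plays a 0 Tge k" g "1 / real T" K] pl1'(1)[OF k] g(3) by force
    have "plays a 0 Tge k n \<le> T" for n using plays_le[of a 0 Tge k n] TgeT by linarith
    then show "beta K M g (1 / real T) (plays a 0 Tge k) \<le> B"
      unfolding B_def using pl1'(1)[OF k] by (intro beta_mono) auto
  qed (use pl1'[OF k] in blast)
  \<comment> \<open>The confidence event speaks of parameter \<open>\<delta>\<close>, the
    exploitation condition of \<open>1 / T\<close>; monotonicity of \<open>beta\<close> in the value
    of \<open>g\<close> links the two widths.\<close>
  have dev2: "\<bar>mixed_mean M W a x 0 Tge k m - \<mu> k m\<bar> \<le> w k m" if k: "k < K" and m: "m < M" for k m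
  proof -
    have "ereal \<bar>mixed_mean M W a x 0 Tge k m - \<mu> k m\<bar> \<le> width K M W g \<delta> (plays a 0 Tge) k m"
      using good k m by simp
    also have "\<dots> = ereal (sqrt (beta K M g \<delta> (plays a 0 Tge k) *
        (\<Sum>n<M. (W n m)\<^sup>2 / real (plays a 0 Tge k n))))"
      using pl1'(1)[OF k] by (intro width_eq) auto
    also have "\<dots> \<le> ereal (w k m)"
      unfolding w_def ereal_less_eq(3) real_sqrt_le_iff
      using pl1'(1)[OF k] g(2) by (intro mult_right_mono beta_mono sum_nonneg) auto
    finally show ?thesis by simp
  qed
  have "exploit_condition K M W g T a x Tge"
    unfolding exploit_condition_def
  proof (intro allI impI)
    fix k m assume k: "k < K" and m: "m < M"
    obtain b where b: "b < K" "\<forall>j<K. j \<noteq> b \<longrightarrow> \<mu> j m < \<mu> b m" using best m by blast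
    have "2 * w k m < gaps K (mixed_mean M W a x 0 Tge) k m"
    proof (rule gap_dominates_widths[OF K b(1), where u = "\<lambda>j. \<mu> j m" and w = "\<lambda>j. w j m"])
      fix j assume j: "j < K"
      show "\<bar>mixed_mean M W a x 0 Tge j m - \<mu> j m\<bar> \<le> w j m" by (rule dev2[OF j m])
      \<comment> \<open>A width is at most 1/6 of \<open>\<Delta>\<close>, and
        \<open>\<Delta>\<close> at most 6/5 of the true gap.\<close>
      show "5 * w j m \<le> gaps K \<mu> j m" using w\<Delta>[OF j m] clip[OF j m] by linarith
    qed (use b k in auto)
    then show "width K M W g (1 / real T) (plays a 0 Tge) k m
        < ereal (gaps K (mixed_mean M W a x 0 Tge) k m / 2)"
      unfolding weq[OF k] by simp
  qed
  with run3 TgeT show ?thesis by simp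
qed

section \<open>Expectation and asymptotics\<close>

text \<open>Pointwise, \<open>N\<close> is at most 2 plus \<open>R\<close> times the indicator of
  the complement of \<open>E\<close>, and that complement has probability at most
  \<open>\<delta>\<close>.\<close>

lemma (in prob_space) nn_integral_enat_le:
  fixes N :: "'a \<Rightarrow> enat"
  assumes N: "N \<in> M \<rightarrow>\<^sub>M count_space UNIV" and E: "E \<in> events" "1 - \<delta> \<le> prob E" and "0 \<le> \<delta>"
    and "\<And>x. x \<in> E \<Longrightarrow> N x = 2" and "\<And>x. x \<in> space M \<Longrightarrow> N x \<le> 2 + enat R"
  shows "(\<integral>\<^sup>+x. ennreal_of_enat (N x) \<partial>M) \<le> ennreal (2 + real R * \<delta>)"
proof -
  have "(\<integral>\<^sup>+x. ennreal_of_enat (N x) \<partial>M) \<le> (\<integral>\<^sup>+x. 2 + of_nat R * indicator (space M - E) x \<partial>M)"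
  proof (rule nn_integral_mono)
    fix x assume x: "x \<in> space M"
    show "ennreal_of_enat (N x) \<le> 2 + of_nat R * indicator (space M - E) x"
    proof (cases "x \<in> E")
      case True
      then have "N x = enat 2" using assms(5) by (simp add: numeral_eq_enat)
      then show ?thesis using True by (simp add: ennreal_of_enat_enat)
    next
      case False
      have "N x \<le> enat (2 + R)" using assms(6)[OF x] by (simp add: numeral_eq_enat)
      then obtain n where n: "N x = enat n" "n \<le> 2 + R" by (cases "N x") auto
      then have "(of_nat n :: ennreal) \<le> of_nat (2 + R)" by (simp only: of_nat_le_iff)
      then have "(of_nat n :: ennreal) \<le> 2 + of_nat R" by (simp only: of_nat_add of_nat_numeral)
      then show ?thesis using False x n(1) by (simp add: ennreal_of_enat_enat)
    qed
  qed
  also have "\<dots> = 2 + of_nat R * emeasure M (space M - E)"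
    using E by (simp add: nn_integral_add nn_integral_cmult emeasure_space_1)
  also have "emeasure M (space M - E) = ennreal (prob (space M - E))"
    by (rule emeasure_eq_measure)
  also have "prob (space M - E) = 1 - prob E" by (rule prob_compl[OF E(1)])
  also have "2 + of_nat R * ennreal (1 - prob E) = ennreal (2 + real R * (1 - prob E))"
    by (simp add: ennreal_plus ennreal_mult ennreal_of_nat_eq_real_of_nat)
  also have "\<dots> \<le> ennreal (2 + real R * \<delta>)"
    using E(2) by (intro ennreal_leI add_left_mono mult_left_mono) auto
  finally show ?thesis .
qed

section \<open>The probability space and the gap constants of an instance\<close>

lemma reward_space_prob:
  assumes "\<And>k m. k < K \<Longrightarrow> m < M \<Longrightarrow> prob_space (\<nu> k m)"
  shows "prob_space (reward_space K M \<nu>)"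
  unfolding reward_space_def
proof (rule prob_space_PiM)
  fix p :: "nat \<times> nat \<times> nat"
  assume "p \<in> {..<K} \<times> {..<M} \<times> {1..}"
  then show "prob_space (case p of (k, m, t) \<Rightarrow> \<nu> k m)"
    using assms by (cases p) auto
qed

lemma bandit_instance_best:
  assumes "bandit_instance K M W \<sigma> \<nu>" and "m < M"
  shows "\<exists>b<K. \<forall>j<K. j \<noteq> b \<longrightarrow> mixed M W (law_mean \<nu>) j m < mixed M W (law_mean \<nu>) b m"
proof -
  let ?\<mu> = "\<lambda>k. mixed M W (law_mean \<nu>) k m"
  have "\<exists>!k. k < K \<and> (\<forall>j<K. ?\<mu> j \<le> ?\<mu> k)" using assms by (simp add: bandit_instance_def)
  then obtain b where b: "b < K" "\<forall>j<K. ?\<mu> j \<le> ?\<mu> b"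
    and uniq: "\<And>k. k < K \<Longrightarrow> \<forall>j<K. ?\<mu> j \<le> ?\<mu> k \<Longrightarrow> k = b" by blast
  have "?\<mu> j < ?\<mu> b" if "j < K" "j \<noteq> b" for j
    using uniq[OF that(1)] b that by (meson not_le order_trans)
  with b show ?thesis by blast
qed

lemma gap_bounds:
  assumes K: "2 \<le> K"
    and best: "\<forall>m<M. \<exists>b<K. \<forall>j<K. j \<noteq> b \<longrightarrow> \<mu> j m < \<mu> b m"
  obtains lo hi :: real where "0 < lo" "0 < hi"
    "\<forall>k<K. \<forall>m<M. 5 * lo \<le> 4 * gaps K \<mu> k m \<and> 6 * gaps K \<mu> k m \<le> 5 * hi"
proof -
  have pos: "0 < gaps K \<mu> k m" if "k < K" "m < M" for k m
  proof -
    obtain b where b: "b < K" "\<forall>j<K. j \<noteq> b \<longrightarrow> \<mu> j m < \<mu> b m" using best \<open>m < M\<close> by blast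
    note u = gap_unique_best[where u = "\<lambda>j. \<mu> j m", OF K b]
    show ?thesis using u(3) u(1)[OF \<open>k < K\<close>] b(2) \<open>k < K\<close> by (cases "k = b") auto
  qed
  define S where "S = (\<lambda>(k, m). gaps K \<mu> k m) ` ({..<K} \<times> {..<M})"
  have fin: "finite S" by (simp add: S_def)
  have mem: "gaps K \<mu> k m \<in> S" if "k < K" "m < M" for k m using that by (force simp: S_def)
  have spos: "0 < x" if "x \<in> S" for x using that pos by (auto simp: S_def)
  \<comment> \<open>Inserting 1 keeps the set nonempty and \<open>hi\<close> positive; the factors
    4/5 and 6/5 provide the slack for estimated gaps.\<close>
  define lo where "lo = 4 / 5 * Min (insert 1 S)"
  define hi where "hi = 6 / 5 * Max (insert 1 S)"
  show ?thesis
  proof (rule that[of lo hi])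
    show "0 < lo" using fin spos by (simp add: lo_def)
    have "1 \<le> Max (insert 1 S)" using fin by (intro Max_ge) auto
    then show "0 < hi" by (simp add: hi_def)
    have "5 * lo \<le> 4 * gaps K \<mu> k m \<and> 6 * gaps K \<mu> k m \<le> 5 * hi" if "k < K" "m < M" for k m
    proof -
      have "Min (insert 1 S) \<le> gaps K \<mu> k m" "gaps K \<mu> k m \<le> Max (insert 1 S)"
        using mem[OF that] fin by (auto intro!: Min_le Max_ge)
      then show ?thesis by (simp add: lo_def hi_def)
    qed
    then show "\<forall>k<K. \<forall>m<M. 5 * lo \<le> 4 * gaps K \<mu> k m \<and> 6 * gaps K \<mu> k m \<le> 5 * hi" by blast
  qed
qed

section \<open>Large horizons and conclusion\<close>

lemma eventually_less_of_tendsto_0: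
  fixes f :: "'a \<Rightarrow> real"
  assumes "(f \<longlongrightarrow> 0) F" "0 < c"
  shows "\<forall>\<^sub>F x in F. f x < c"
  using order_tendstoD(2)[OF assms] .

theorem lemma6:
  fixes K M :: nat
    and W :: "nat \<Rightarrow> nat \<Rightarrow> real"
    and \<sigma> :: real
    and \<nu> :: "nat \<Rightarrow> nat \<Rightarrow> real measure"
    and g :: "real \<Rightarrow> real"
  assumes "bandit_instance K M W \<sigma> \<nu>"
    and "threshold_function K M W \<nu> g"
  shows "\<exists>T\<^sub>0::nat. \<forall>T\<ge>T\<^sub>0. \<forall>a N. cexp2_execution K M W \<nu> g T a N \<longrightarrow>
    (\<integral>\<^sup>+x. ennreal_of_enat (N x) \<partial>reward_space K M \<nu>)
      \<le> ennreal (2 + real_of_int (max 1 \<lceil>log 2 (8 / min_gap K M W \<nu>)\<rceil>) / ln (real T)) \<and>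
    measure (reward_space K M \<nu>) {x \<in> space (reward_space K M \<nu>). N x = 2} \<ge> 1 - 1 / ln (real T)"
proof -
  define \<mu> where "\<mu> = mixed M W (law_mean \<nu>)"
  have K: "2 \<le> K" and M: "1 \<le> M" and W: "\<forall>n<M. \<forall>m<M. 0 \<le> W n m \<and> W n m \<le> 1"
    and W1: "\<forall>m<M. (\<Sum>n<M. W n m) = 1"
    and \<nu>: "\<And>k m. k < K \<Longrightarrow> m < M \<Longrightarrow> prob_space (\<nu> k m)"
    using assms(1) unfolding bandit_instance_def sub_gaussian_def by blast+
  interpret prob_space "reward_space K M \<nu>" by (rule reward_space_prob[OF \<nu>])
  have best: "\<forall>m<M. \<exists>b<K. \<forall>j<K. j \<noteq> b \<longrightarrow> \<mu> j m < \<mu> b m"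
    unfolding \<mu>_def using bandit_instance_best[OF assms(1)] by blast
  obtain lo hi where lo: "0 < lo" and hi: "0 < hi" and gaps:
    "\<forall>k<K. \<forall>m<M. 5 * lo \<le> 4 * gaps K \<mu> k m \<and> 6 * gaps K \<mu> k m \<le> 5 * hi"
    by (rule gap_bounds[OF K best])
  obtain \<delta>0 where \<delta>0: "0 < \<delta>0" "\<delta>0 \<le> 1" and g: "\<forall>\<delta>. 0 < \<delta> \<and> \<delta> < \<delta>0 \<longrightarrow>
      ln (1 / \<delta>) / 2 \<le> g \<delta> \<and> g \<delta> \<le> (2 + 2 * real M) * ln (1 / \<delta>)"
    by (rule threshold_bounds[OF assms(2)])
  note g = g[rule_format, OF conjI]
  define A where "A = real K * real M"
  define m where "m = real M"
  define Q where "Q = 2 * real K * (real M)\<^sup>2 * hi / lo ^ 3"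
  have m: "1 \<le> m" using M by (simp add: m_def)
  have "2 * 1 \<le> A" unfolding A_def using K M by (intro mult_mono) auto
  then have A: "1 \<le> A" by simp
  have Q: "0 < Q" using K M hi lo by (simp add: Q_def)
  \<comment> \<open>These conditions involve only constants of the instance, so one threshold on
    \<open>T\<close> serves all executions.\<close>
  have "\<forall>\<^sub>F T::nat in sequentially. 1 < ln (real T) \<and> ln (real T) ^ 3 \<le> real T"
    by (intro eventually_conj; real_asymp)
  moreover have "\<forall>\<^sub>F T::nat in sequentially. 1 / ln (real T) ^ 3 / A < \<delta>0"
    by (rule eventually_less_of_tendsto_0[OF _ \<delta>0(1)]) (use A in real_asymp)
  moreover have "\<forall>\<^sub>F T::nat in sequentially. 1 / real T / A < \<delta>0"
    by (rule eventually_less_of_tendsto_0[OF _ \<delta>0(1)]) (use A in real_asymp)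
  \<comment> \<open>Accuracy of the initial exploration with \<open>\<epsilon> = lo / 8\<close>: the
    left side is of order \<open>ln (ln T) / sqrt (ln T)\<close>.\<close>
  moreover have "\<forall>\<^sub>F T::nat in sequentially. 2 * ((2 + 2 * m) * ln (A * ln (real T) ^ 3)
      + 2 * (m * ln (4 + ln (sqrt (ln (real T)) + 1)))) * m / sqrt (ln (real T)) < (lo / 8)\<^sup>2"
    by (rule eventually_less_of_tendsto_0) (use A m lo in \<open>real_asymp | simp\<close>)+
  moreover have "\<forall>\<^sub>F T::nat in sequentially. 1 / ln (ln (real T)) < lo"
    by (rule eventually_less_of_tendsto_0[OF _ lo]) real_asymp
  moreover have "\<forall>\<^sub>F T::nat in sequentially. hi < ln (ln (real T))"
    by real_asymp
  \<comment> \<open>Both exploration phases together last \<open>O(ln T)\<close> steps and so fit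
    into the horizon.\<close>
  moreover have "\<forall>\<^sub>F T::nat in sequentially. (real K * (sqrt (ln (real T)) + 1) + real K * (18 * Q *
      (2 * ((2 + 2 * m) * ln (A * real T) + 2 * (m * ln (4 + ln (real T))))) + 1)) / real T < 1"
    by (rule eventually_less_of_tendsto_0) (use A m K Q in \<open>real_asymp | simp\<close>)+
  moreover have "\<forall>\<^sub>F T::nat in sequentially. 2 \<le> ln (A * real T)"
    using A by real_asymp
  moreover have "\<forall>\<^sub>F T::nat in sequentially. (ln (m\<^sup>2 * real T) + 2) / (ln (real T))\<^sup>2 < 1"
    by (rule eventually_less_of_tendsto_0) (use m in \<open>real_asymp | simp\<close>)+
  ultimately have "\<forall>\<^sub>F T::nat in sequentially. \<forall>a N. cexp2_execution K M W \<nu> g T a N \<longrightarrow>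
    (\<integral>\<^sup>+x. ennreal_of_enat (N x) \<partial>reward_space K M \<nu>)
      \<le> ennreal (2 + real_of_int (max 1 \<lceil>log 2 (8 / min_gap K M W \<nu>)\<rceil>) / ln (real T)) \<and>
    measure (reward_space K M \<nu>) {x \<in> space (reward_space K M \<nu>). N x = 2} \<ge> 1 - 1 / ln (real T)"
  proof eventually_elim
    case (elim T)
    define L where "L = ln (real T)"
    \<comment> \<open>\<open>R\<close> below is \<open>O(L)\<close>, so \<open>\<delta> = O(1 / L\<^sup>2)\<close> would be enough up to constants; the third power absorbs them.\<close>
    define \<delta> where "\<delta> = 1 / L ^ 3"
    \<comment> \<open>\<open>4 ^ R\<close> has to exceed \<open>m^2 * T\<close>. As
      \<open>exp 1 < 4\<close>, an \<open>R\<close> above the logarithm suffices; the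
      \<open>+ 1\<close> makes this strict.\<close>
    define R where "R = nat \<lceil>ln (m\<^sup>2 * real T)\<rceil> + 1"
    define \<tau>1 where "\<tau>1 = initial_plays T"
    have L: "1 < L" "L ^ 3 \<le> real T" using elim(1) by (simp_all add: L_def)
    have L3: "1 < L ^ 3" "L \<le> L ^ 3"
      using L(1) one_less_power[of L 3] power_increasing[of 1 3 L] by simp_all
    have T: "1 < real T" using L L3 by linarith
    have \<delta>: "0 < \<delta>" "\<delta> < 1" "\<delta> \<le> 1 / L" "1 / real T \<le> \<delta>"
      using L L3 T unfolding \<delta>_def by (simp_all add: frac_le)
    have \<delta>A: "0 < \<delta> / A" "\<delta> / A < \<delta>0" using \<delta> A elim(2) by (auto simp: \<delta>_def L_def)
    have TA: "0 < 1 / real T / A" "1 / real T / A < \<delta>0" using T A elim(3) by auto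
    have gT: "1 \<le> g (1 / real T / A)"
      using g[OF TA] elim(8) by (simp add: mult.commute)
    have "1 < A / \<delta>" using \<delta> A by (simp add: less_divide_eq)
    then have "0 \<le> ln (1 / (\<delta> / A))" by (intro ln_ge_zero) simp
    then have g\<delta>: "0 \<le> g (\<delta> / A)" using g[OF \<delta>A] by linarith
    \<comment> \<open>Monotonicity is available only inside the unit interval, which
      \<open>\<delta>0 \<le> 1\<close> guarantees for both arguments.\<close>
    have "antimono_on {0<..<1} g" using assms(2) by (simp add: threshold_function_def)
    moreover have "1 / real T / A \<le> \<delta> / A" using \<delta>(4) A by (intro divide_right_mono) auto
    moreover have "1 / real T / A \<in> {0<..<1}" "\<delta> / A \<in> {0<..<1}"
      using \<delta>A TA \<delta>0 unfolding greaterThanLessThan_iff by linarith+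
    ultimately have gmono: "g (\<delta> / A) \<le> g (1 / real T / A)"
      using monotone_onD[of "{0<..<1}" "(\<le>)" "(\<ge>)" g] by blast
    have sL: "1 < sqrt L" using L by simp
    have \<tau>1: "sqrt L \<le> real \<tau>1" "real \<tau>1 \<le> sqrt L + 1"
      using sL unfolding \<tau>1_def initial_plays_def L_def[symmetric] by linarith+
    have \<tau>1': "1 \<le> \<tau>1" using \<tau>1(1) sL by linarith

    show ?case
    proof (intro allI impI)
      fix a N
      assume "cexp2_execution K M W \<nu> g T a N"
      then have exec: "non_anticipating K M \<nu> a" "N \<in> reward_space K M \<nu> \<rightarrow>\<^sub>M count_space UNIV"
        and run: "\<And>x. x \<in> space (reward_space K M \<nu>) \<Longrightarrow> cexp2_run K M W g T (\<lambda>t m. a t m x) x (N x)"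
        by (auto simp: cexp2_execution_def)
      define E where "E = {x \<in> space (reward_space K M \<nu>). \<forall>t. \<forall>k<K. \<forall>m<M.
          ereal \<bar>mixed_mean M W (\<lambda>u n. a u n x) x 0 t k m - \<mu> k m\<bar>
          \<le> width K M W g \<delta> (plays (\<lambda>u n. a u n x) 0 t) k m}"
      have E: "1 - \<delta> \<le> prob E"
        unfolding E_def \<mu>_def using assms(2) exec(1) \<delta> unfolding threshold_function_def by blast
      \<comment> \<open>Nonmeasurable sets have \<open>measure\<close> 0, so positive probability
        yields measurability of \<open>E\<close>.\<close>
      then have "prob E \<noteq> 0" using \<delta> by linarith
      then have Es: "E \<in> events" using measure_notin_sets by blast

      have "m\<^sup>2 * real T < 4 ^ R"
      proof -
        have pos: "0 < m\<^sup>2 * real T" using m T by simp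
        then have "m\<^sup>2 * real T = exp (ln (m\<^sup>2 * real T))" by simp
        also have "\<dots> < exp (real R)" unfolding R_def by simp linarith
        also have "\<dots> = exp 1 ^ R" by (simp flip: exp_of_nat_mult)
        also have "\<dots> \<le> 4 ^ R" using exp_le by (intro power_mono) auto
        finally show ?thesis .
      qed
      then have Nle: "N x \<le> 2 + enat R" if "x \<in> space (reward_space K M \<nu>)" for x
        using cexp2_run_rounds[OF K M W1 _ _ run[OF that], of R] gT by (simp add: A_def m_def)

      have N2: "N x = 2" if x: "x \<in> E" for x
      proof (rule cexp2_run_two_rounds[where \<epsilon> = "lo / 8" and \<delta> = \<delta> and \<mu> = \<mu> and lo = lo and hi = hi,
            OF K M _ W best _ _ _ _ _ _ _ _ gaps])
        show "cexp2_run K M W g T (\<lambda>t m. a t m x) x (N x)" using x run by (simp add: E_def)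
        show "\<forall>t. \<forall>k<K. \<forall>m<M. ereal \<bar>mixed_mean M W (\<lambda>u n. a u n x) x 0 t k m - \<mu> k m\<bar>
          \<le> width K M W g \<delta> (plays (\<lambda>u n. a u n x) 0 t) k m" using x by (simp add: E_def)
        show "0 \<le> g (\<delta> / (real K * real M))"
          "g (\<delta> / (real K * real M)) \<le> g (1 / real T / (real K * real M))"
          "0 < g (1 / real T / (real K * real M))"
          using g\<delta> gmono gT by (simp_all add: A_def)
        show "1 \<le> initial_plays T" using \<tau>1' by (simp add: \<tau>1_def)
        show "1 \<le> T" using T by simp
        show "8 * (lo / 8) \<le> lo" "0 \<le> lo / 8" "1 / ln (ln (real T)) \<le> lo" "0 < lo" "hi \<le> ln (ln (real T))"
          using elim(5,6) lo by simp_all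
        show "beta K M g \<delta> (\<lambda>_. initial_plays T) * real M / real (initial_plays T) \<le> (lo / 8)\<^sup>2"
        proof -
          let ?b = "2 * ((2 + 2 * m) * ln (A * L ^ 3) + 2 * (m * ln (4 + ln (sqrt L + 1))))"
          have "0 \<le> ln (real \<tau>1)" "ln (real \<tau>1) \<le> ln (sqrt L + 1)" using \<tau>1' \<tau>1(2) by auto
          then have "m * ln (4 + ln (real \<tau>1)) \<le> m * ln (4 + ln (sqrt L + 1))"
            using m by (intro mult_left_mono) auto
          moreover have "g (\<delta> / A) \<le> (2 + 2 * m) * ln (A * L ^ 3)"
            using g[OF \<delta>A] by (simp add: m_def \<delta>_def mult.commute)
          ultimately have b: "beta K M g \<delta> (\<lambda>_. \<tau>1) \<le> ?b"
            by (simp add: beta_def A_def m_def)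
          have b0: "0 \<le> beta K M g \<delta> (\<lambda>_. \<tau>1)"
            using beta_ge[of M "\<lambda>_. \<tau>1" g \<delta> K] g\<delta> \<tau>1' by (simp add: A_def)
          \<comment> \<open>The upper bound \<open>sqrt L + 1\<close> on \<open>\<tau>1\<close>
            enters through \<open>beta\<close>, the lower bound \<open>sqrt L\<close> through the
            denominator.\<close>
          have "beta K M g \<delta> (\<lambda>_. \<tau>1) * m / real \<tau>1 \<le> ?b * m / sqrt L"
            using b b0 m L \<tau>1(1) by (intro frac_le mult_right_mono mult_nonneg_nonneg) auto
          then show ?thesis using elim(4) by (simp add: L_def \<tau>1_def m_def)
        qed
        show "real K * real (initial_plays T) + real K * (18 * (2 * real K * (real M)\<^sup>2 * hi / lo ^ 3) *
            beta K M g (1 / real T) (\<lambda>_. T) + 1) \<le> real T"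
        proof -
          let ?B = "2 * ((2 + 2 * m) * ln (A * real T) + 2 * (m * ln (4 + ln (real T))))"
          have "g (1 / real T / A) \<le> (2 + 2 * m) * ln (A * real T)"
            using g[OF TA] by (simp add: m_def mult.commute)
          then have "beta K M g (1 / real T) (\<lambda>_. T) \<le> ?B" by (simp add: beta_def A_def m_def)
          then have "real K * real \<tau>1 + real K * (18 * Q * beta K M g (1 / real T) (\<lambda>_. T) + 1)
              \<le> real K * (sqrt L + 1) + real K * (18 * Q * ?B + 1)"
            using \<tau>1(2) Q by (intro add_mono mult_left_mono) auto
          also have "\<dots> \<le> real T" using elim(7) T by (simp add: L_def)
          finally show ?thesis by (simp add: Q_def \<tau>1_def)
        qed
      qed

      have "real R * \<delta> \<le> 1 / L"
      proof -
        have "1 \<le> m\<^sup>2 * real T" using m T by (metis less_imp_le mult_mono' mult_1 one_le_power zero_le_one)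
        then have "0 \<le> ln (m\<^sup>2 * real T)" by simp
        then have "real R \<le> ln (m\<^sup>2 * real T) + 2" unfolding R_def by simp linarith
        also have "\<dots> \<le> L\<^sup>2" using elim(9) L by (simp add: L_def)
        finally have "real R * \<delta> \<le> L\<^sup>2 * \<delta>" using \<delta> by (intro mult_right_mono) auto
        also have "\<dots> = 1 / L" using L by (simp add: \<delta>_def power2_eq_square power3_eq_cube)
        finally show ?thesis .
      qed
      \<comment> \<open>The maximum with 1 makes the numerator at least 1.\<close>
      also have "\<dots> \<le> real_of_int (max 1 \<lceil>log 2 (8 / min_gap K M W \<nu>)\<rceil>) / L"
        using L by (intro divide_right_mono) auto
      finally have bound: "real R * \<delta> \<le> real_of_int (max 1 \<lceil>log 2 (8 / min_gap K M W \<nu>)\<rceil>) / L" .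
      have "(\<integral>\<^sup>+x. ennreal_of_enat (N x) \<partial>reward_space K M \<nu>) \<le> ennreal (2 + real R * \<delta>)"
        using \<delta> by (intro nn_integral_enat_le[OF exec(2) Es E _ N2 Nle]) auto
      also have "\<dots> \<le> ennreal (2 + real_of_int (max 1 \<lceil>log 2 (8 / min_gap K M W \<nu>)\<rceil>) / L)"
        using bound by (intro ennreal_leI) simp
      finally have 1: "(\<integral>\<^sup>+x. ennreal_of_enat (N x) \<partial>reward_space K M \<nu>)
          \<le> ennreal (2 + real_of_int (max 1 \<lceil>log 2 (8 / min_gap K M W \<nu>)\<rceil>) / L)" .
      have "1 - 1 / L \<le> prob E" using E \<delta> by linarith
      \<comment> \<open>Every point of \<open>E\<close> has exactly two rounds, and
        \<open>\<delta> \<le> 1 / L\<close>.\<close>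
      also have "\<dots> \<le> prob {x \<in> space (reward_space K M \<nu>). N x = 2}"
      proof (rule finite_measure_mono)
        show "E \<subseteq> {x \<in> space (reward_space K M \<nu>). N x = 2}" using N2 by (auto simp: E_def)
        show "{x \<in> space (reward_space K M \<nu>). N x = 2} \<in> events"
          using measurable_sets[OF exec(2), of "{2}"] by (simp add: vimage_def Int_def conj_commute)
      qed
      finally show "(\<integral>\<^sup>+x. ennreal_of_enat (N x) \<partial>reward_space K M \<nu>)
          \<le> ennreal (2 + real_of_int (max 1 \<lceil>log 2 (8 / min_gap K M W \<nu>)\<rceil>) / ln (real T)) \<and>
        measure (reward_space K M \<nu>) {x \<in> space (reward_space K M \<nu>). N x = 2} \<ge> 1 - 1 / ln (real T)"
        using 1 unfolding L_def by simp
    qed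
  qed
  then show ?thesis unfolding eventually_sequentially by blast
qed

end
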